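(* The smash coproduct $\mathcal H^{\mathrm{qed}}:=\mathcal H^\alpha\ltimes\mathcal H^e$, i.e. the tensor product algebra $\mathcal H^\alpha\otimes\mathcal H^e$ endowed with the coproduct $$\Delta^{\mathrm{qed}}(a\otimes b)=\Delta^\alpha(a)\,\big[(\delta^e\otimes\mathrm{Id})\Delta^p_e(b)\big],\qquad a\in\mathcal H^\alpha,\ b\in\mathcal H^e,$$ and counit $a\otimes b\mapsto\epsilon(a)\epsilon(b)$, is a graded connected Hopf algebra, which is neither commutative nor cocommutative. The grading is given by the sum of the orders of all the trees appearing in a monomial.
   Context: All vector spaces and algebras are over $\mathbb C$. $Y=\bigcup_{n\ge0}Y_n$ is the set of planar binary trees, $Y_n$ being the trees with $n$ internal vertices; $|t|=n$ (the order) for $t\in Y_n$. $|$ denotes the unique tree of order $0$. $t\vee s$ is the tree obtained by grafting $t$ (left) and $s$ (right) on a new root; every tree other than $|$ is uniquely of the form $t^l\vee t^r$. $\mathbb CY$ is the vector space with basis $Y$, and $V:\mathbb CY\to\mathbb CY$ is the linear map $V(t)=|\vee t$. Over product: the associative product $/$ on $\mathbb CY$ given by $t/|=t$, $t/(s^l\vee s^r)=(t/s^l)\vee s^r$; unit $|$; $t\vee s=t/V(s)$; $(\mathbb CY,/)$ is the free associative algebra on the trees $V(t)$. On tensor products $/$ is applied componentwise. Linear maps $\widetilde\Delta,\widetilde\delta:\mathbb CY\to\mathbb CY\otimes\mathbb CY$ are defined by recursion on the order: $\widetilde\Delta(|)=\widetilde\delta(|)=|\otimes|$, $\ \widetilde\delta(V(t))=(V\otimes\mathrm{Id})\widetilde\delta(t)$,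 $\ \widetilde\Delta(V(t))=|\otimes V(t)+\widetilde\delta(V(t))$, $\ \widetilde\Delta(t\vee s)=\widetilde\Delta(t)/\widetilde\Delta(V(s))$, $\ \widetilde\delta(t\vee s)=\widetilde\Delta(t)/\widetilde\delta(V(s))$. $\mathcal H^\alpha=\mathbb C[V(t),t\in Y]$ is the commutative polynomial algebra on the $V(t)$, identified with the abelianization of $(\mathbb CY,/)$ (unit $|$, product $/$), with quotient map $\pi:\mathbb CY\to\mathcal H^\alpha$; it is a Hopf algebra with coproduct the algebra morphism $\Delta^\alpha$ such that $\Delta^\alpha(V(t))=(\pi\otimes\pi)\widetilde\Delta(V(t))$, and counit $\epsilon(|)=1$, $\epsilon(V(t))=0$. $\mathcal H^e=\mathbb C\langle Y\rangle/(1-|)$ is the free associative algebra on the set of trees with $|$ identified with the unit; its product is written by juxtaposition $s_1\ldots s_n$. It is a Hopf algebra with coproduct the algebra morphism $\Delta^p_e$ (pruning coproduct) given on trees by $\Delta^p_e(|)=|\otimes|$ and $\Delta^p_e(t\vee s)=|\otimes(t\vee s)+\sum (t\vee s_{(1)})\otimes s_{(2)}$, where $\Delta^p_e(s)=\sum s_{(1)}\otimes s_{(2)}$, and counit $\epsilon$ vanishing on all trees other than $|$. $\delta^e:\mathcal H^e\to\mathcal H^e\otimes\mathcal H^\alpha$ is the algebra morphism given on single trees by $\delta^e(t)=(\mathrm{Id}\otimes\pi)\widetilde\delta(t)$. In the formula for $\Delta^{\mathrm{qed}}$, with $\Delta^\alpha(a)=\sum a_{(1)}\otimes a_{(2)}$,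 $\Delta^p_e(b)=\sum b_{(1)}\otimes b_{(2)}$, $\delta^e(b)=\sum b_{(e)}\otimes b_{(\alpha)}$, the meaning is $\Delta^{\mathrm{qed}}(a\otimes b)=\sum \big(a_{(1)}\otimes (b_{(1)})_{(e)}\big)\otimes\big(a_{(2)}/(b_{(1)})_{(\alpha)}\otimes b_{(2)}\big)$. "Graded connected" means that the structure maps respect the grading and the degree $0$ component is $\mathbb C$. *)

theory Defs
  imports Complex_Main "HOL-Library.Poly_Mapping" "HOL-Library.Product_Plus" "HOL-Library.Multiset"
begin

section \<open>Complex vector spaces with a distinguished basis and their tensor products\<close>

text \<open>
  The complex vector space with basis \<open>'b\<close> is \<open>'b \<Rightarrow>\<^sub>0 complex\<close>, and the tensor product of the
  spaces with bases \<open>'a\<close> and \<open>'b\<close> is the space with basis \<open>'a \<times> 'b\<close>.  If the basis \<open>'b\<close> is a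
  monoid (written additively, class \<^class>\<open>monoid_add\<close>), the ring structure of
  \<open>'b \<Rightarrow>\<^sub>0 complex\<close> in the library is that of the monoid algebra, so it is an associative unital
  algebra with unit \<open>1 = single 0 1\<close>.  On \<open>'a \<times> 'b\<close> the monoid operation is componentwise, so
  that the library multiplication is the one of the tensor product of algebras
  (see \<open>tensor_mult\<close> below).
\<close>

definition smult :: "complex \<Rightarrow> ('b \<Rightarrow>\<^sub>0 complex) \<Rightarrow> ('b \<Rightarrow>\<^sub>0 complex)" where
  "smult c = Poly_Mapping.map ((*) c)"

abbreviation basis :: "'b \<Rightarrow> ('b \<Rightarrow>\<^sub>0 complex)" where
  "basis b \<equiv> Poly_Mapping.single b 1"

definition lin_ext :: "('b \<Rightarrow> ('c \<Rightarrow>\<^sub>0 complex)) \<Rightarrow> ('b \<Rightarrow>\<^sub>0 complex) \<Rightarrow> ('c \<Rightarrow>\<^sub>0 complex)" where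
  "lin_ext f p = (\<Sum>b\<in>Poly_Mapping.keys p. smult (Poly_Mapping.lookup p b) (f b))"

definition tensor :: "('a \<Rightarrow>\<^sub>0 complex) \<Rightarrow> ('b \<Rightarrow>\<^sub>0 complex) \<Rightarrow> ('a \<times> 'b \<Rightarrow>\<^sub>0 complex)"
    (infixr \<open>\<otimes>\<close> 75) where
  "p \<otimes> q = (\<Sum>a\<in>Poly_Mapping.keys p. \<Sum>b\<in>Poly_Mapping.keys q.
     Poly_Mapping.single (a, b) (Poly_Mapping.lookup p a * Poly_Mapping.lookup q b))"

definition tensor_map ::
    "(('a \<Rightarrow>\<^sub>0 complex) \<Rightarrow> ('c \<Rightarrow>\<^sub>0 complex)) \<Rightarrow> (('b \<Rightarrow>\<^sub>0 complex) \<Rightarrow> ('d \<Rightarrow>\<^sub>0 complex)) \<Rightarrow>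
     ('a \<times> 'b \<Rightarrow>\<^sub>0 complex) \<Rightarrow> ('c \<times> 'd \<Rightarrow>\<^sub>0 complex)" where
  "tensor_map f g = lin_ext (\<lambda>(a, b). f (basis a) \<otimes> g (basis b))"

definition tensor_assoc :: "(('a \<times> 'b) \<times> 'c \<Rightarrow>\<^sub>0 complex) \<Rightarrow> ('a \<times> 'b \<times> 'c \<Rightarrow>\<^sub>0 complex)" where
  "tensor_assoc = lin_ext (\<lambda>((a, b), c). basis (a, b, c))"

definition tensor_swap :: "('a \<times> 'b \<Rightarrow>\<^sub>0 complex) \<Rightarrow> ('b \<times> 'a \<Rightarrow>\<^sub>0 complex)" where
  "tensor_swap = lin_ext (\<lambda>(a, b). basis (b, a))"

definition mult_map :: "('b::monoid_add \<times> 'b \<Rightarrow>\<^sub>0 complex) \<Rightarrow> ('b \<Rightarrow>\<^sub>0 complex)" where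
  "mult_map = lin_ext (\<lambda>(a, b). basis a * basis b)"

text \<open>\<open>counit_left\<close> is \<open>\<epsilon> \<otimes> Id\<close> followed by the identification \<open>\<complex> \<otimes> A = A\<close>; similarly
  \<open>counit_right\<close>.\<close>

definition counit_left ::
    "(('b \<Rightarrow>\<^sub>0 complex) \<Rightarrow> complex) \<Rightarrow> ('b \<times> 'b \<Rightarrow>\<^sub>0 complex) \<Rightarrow> ('b \<Rightarrow>\<^sub>0 complex)" where
  "counit_left \<epsilon> = lin_ext (\<lambda>(a, b). smult (\<epsilon> (basis a)) (basis b))"

definition counit_right ::
    "(('b \<Rightarrow>\<^sub>0 complex) \<Rightarrow> complex) \<Rightarrow> ('b \<times> 'b \<Rightarrow>\<^sub>0 complex) \<Rightarrow> ('b \<Rightarrow>\<^sub>0 complex)" where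
  "counit_right \<epsilon> = lin_ext (\<lambda>(a, b). smult (\<epsilon> (basis b)) (basis a))"

lemma lookup_smult [simp]:
  "Poly_Mapping.lookup (smult c p) b = c * Poly_Mapping.lookup p b"
  by (simp add: smult_def map.rep_eq when_def)

lemma vector_space_smult: "vector_space (smult :: complex \<Rightarrow> ('b \<Rightarrow>\<^sub>0 complex) \<Rightarrow> _)"
  by unfold_locales (auto intro!: poly_mapping_eqI simp: lookup_add algebra_simps)

lemma lin_ext_superset:
  assumes "finite A" "Poly_Mapping.keys p \<subseteq> A"
  shows "lin_ext f p = (\<Sum>b\<in>A. smult (Poly_Mapping.lookup p b) (f b))"
proof -
  have "smult 0 q = 0" for q :: "'c \<Rightarrow>\<^sub>0 complex"
    by (auto intro!: poly_mapping_eqI)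
  thus ?thesis
    unfolding lin_ext_def using assms
    by (intro sum.mono_neutral_left) (auto simp: in_keys_iff)
qed

lemma linear_lin_ext: "Vector_Spaces.linear smult smult (lin_ext f)"
proof -
  interpret V: vector_space "smult :: complex \<Rightarrow> ('a \<Rightarrow>\<^sub>0 complex) \<Rightarrow> _" by (rule vector_space_smult)
  interpret W: vector_space "smult :: complex \<Rightarrow> ('b \<Rightarrow>\<^sub>0 complex) \<Rightarrow> _" by (rule vector_space_smult)
  show ?thesis
  proof
    fix p q :: "'a \<Rightarrow>\<^sub>0 complex" and c :: complex
    let ?A = "Poly_Mapping.keys p \<union> Poly_Mapping.keys q"
    have "Poly_Mapping.keys (p + q) \<subseteq> ?A" by (rule keys_add)
    thus "lin_ext f (p + q) = lin_ext f p + lin_ext f q"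
      by (simp add: lin_ext_superset[where A = ?A] lookup_add W.scale_left_distrib sum.distrib)
    have "Poly_Mapping.keys (smult c p) \<subseteq> Poly_Mapping.keys p" by (auto simp: in_keys_iff)
    thus "lin_ext f (smult c p) = smult c (lin_ext f p)"
      by (simp add: lin_ext_superset[where A = "Poly_Mapping.keys p"] W.scale_sum_right)
  qed
qed

lemma lin_ext_basis [simp]: "lin_ext f (basis b) = f b"
  by (auto intro!: poly_mapping_eqI simp: lin_ext_def)

lemma lin_ext_add: "lin_ext f (p + q) = lin_ext f p + lin_ext f q"
  and lin_ext_smult: "lin_ext f (smult c p) = smult c (lin_ext f p)"
proof -
  interpret L: Vector_Spaces.linear smult smult "lin_ext f" by (rule linear_lin_ext)
  show "lin_ext f (p + q) = lin_ext f p + lin_ext f q" "lin_ext f (smult c p) = smult c (lin_ext f p)"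
    by (rule L.add, rule L.scale)
qed

lemma lookup_tensor:
  "Poly_Mapping.lookup (p \<otimes> q) (a, b) = Poly_Mapping.lookup p a * Poly_Mapping.lookup q b"
proof -
  have "Poly_Mapping.lookup (p \<otimes> q) (a, b) =
    (\<Sum>x\<in>Poly_Mapping.keys p. \<Sum>y\<in>Poly_Mapping.keys q. if x = a \<and> y = b then
       Poly_Mapping.lookup p a * Poly_Mapping.lookup q b else 0)"
    unfolding tensor_def lookup_sum
    by (intro sum.cong refl) (auto simp: lookup_single when_def)
  also have "\<dots> = (\<Sum>x\<in>Poly_Mapping.keys p. if x = a then (\<Sum>y\<in>Poly_Mapping.keys q. if y = b then
       Poly_Mapping.lookup p a * Poly_Mapping.lookup q b else 0) else 0)"
    by (intro sum.cong refl) auto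
  also have "\<dots> = Poly_Mapping.lookup p a * Poly_Mapping.lookup q b"
    by (auto simp: in_keys_iff)
  finally show ?thesis .
qed

lemma tensor_basis [simp]: "basis a \<otimes> basis b = basis (a, b)"
  by (auto intro!: poly_mapping_eqI simp: lookup_tensor lookup_single when_def)

lemma tensor_add_left: "(p + p') \<otimes> q = p \<otimes> q + p' \<otimes> q"
  and tensor_add_right: "p \<otimes> (q + q') = p \<otimes> q + p \<otimes> q'"
  and tensor_smult_left: "smult c p \<otimes> q = smult c (p \<otimes> q)"
  and tensor_smult_right: "p \<otimes> smult c q = smult c (p \<otimes> q)"
  by (auto intro!: poly_mapping_eqI simp: lookup_tensor lookup_add algebra_simps)

lemma single_induct [case_names zero add single]:
  assumes "P 0" "\<And>p q. P p \<Longrightarrow> P q \<Longrightarrow> P (p + q)" "\<And>b c. P (Poly_Mapping.single b c)"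
  shows "P (p :: 'b \<Rightarrow>\<^sub>0 complex)"
proof -
  have "P (\<Sum>k\<in>A. Poly_Mapping.single k (Poly_Mapping.lookup p k))" if "finite A" for A
    using that by induction (auto intro: assms)
  moreover have "(\<Sum>k\<in>Poly_Mapping.keys p. Poly_Mapping.single k (Poly_Mapping.lookup p k)) = p"
    by (rule poly_mapping_eqI) (auto simp: lookup_sum lookup_single when_def in_keys_iff)
  ultimately show ?thesis by (metis finite_keys)
qed

lemma vector_induct [case_names zero add scale basis]:
  assumes "P 0" "\<And>p q. P p \<Longrightarrow> P q \<Longrightarrow> P (p + q)" "\<And>c p. P p \<Longrightarrow> P (smult c p)"
    "\<And>b. P (basis b)"
  shows "P p"
proof (induction p rule: single_induct)
  case (single k v)
  have "Poly_Mapping.single k v = smult v (basis k)"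
    by (auto intro!: poly_mapping_eqI simp: lookup_single when_def)
  thus ?case using assms by simp
qed (use assms in auto)

lemma smult_mult_left: "smult c p * q = smult c (p * q)"
  and smult_mult_right: "p * smult c q = smult c (p * q)"
  for p q :: "'b::monoid_add \<Rightarrow>\<^sub>0 complex"
proof -
  have "p * Poly_Mapping.single 0 c = Poly_Mapping.single 0 c * p"
  proof (induction p rule: single_induct)
    case (single k v)
    show ?case by (simp add: mult_single mult.commute)
  qed (simp_all add: algebra_simps)
  thus "smult c p * q = smult c (p * q)" "p * smult c q = smult c (p * q)"
    unfolding smult_def mult_map_scale_conv_mult by (metis mult.assoc)+
qed

lemma tensor_mult:
  "(p \<otimes> q) * (p' \<otimes> q') = (p * p') \<otimes> (q * q')"
  for p p' :: "'a::monoid_add \<Rightarrow>\<^sub>0 complex" and q q' :: "'b::monoid_add \<Rightarrow>\<^sub>0 complex"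
proof -
  have 0: "0 \<otimes> y = 0" "x \<otimes> 0 = 0" for x :: "'c \<Rightarrow>\<^sub>0 complex" and y :: "'d \<Rightarrow>\<^sub>0 complex"
    by (auto simp: tensor_def)
  note dist = tensor_add_left tensor_add_right tensor_smult_left tensor_smult_right
    smult_mult_left smult_mult_right ring_distribs 0
  show ?thesis
  proof (induction p rule: vector_induct)
    case (basis a)
    show ?case
    proof (induction q rule: vector_induct)
      case (basis b)
      show ?case
      proof (induction p' rule: vector_induct)
        case (basis a')
        show ?case
        proof (induction q' rule: vector_induct)
          case (basis b')
          show ?case by (simp add: mult_single)
        qed (simp_all add: dist)
      qed (simp_all add: dist)
    qed (simp_all add: dist)
  qed (simp_all add: dist)
qed


section \<open>Graded connected Hopf algebras\<close>

definition is_coalgebra ::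
    "(('b \<Rightarrow>\<^sub>0 complex) \<Rightarrow> ('b \<times> 'b \<Rightarrow>\<^sub>0 complex)) \<Rightarrow> (('b \<Rightarrow>\<^sub>0 complex) \<Rightarrow> complex) \<Rightarrow> bool" where
  "is_coalgebra \<Delta> \<epsilon> \<longleftrightarrow>
     Vector_Spaces.linear smult smult \<Delta> \<and>
     Vector_Spaces.linear smult (*) \<epsilon> \<and>
     (\<forall>x. tensor_assoc (tensor_map \<Delta> id (\<Delta> x)) = tensor_map id \<Delta> (\<Delta> x)) \<and>
     (\<forall>x. counit_left \<epsilon> (\<Delta> x) = x) \<and>
     (\<forall>x. counit_right \<epsilon> (\<Delta> x) = x)"

definition is_bialgebra ::
    "(('b::monoid_add \<Rightarrow>\<^sub>0 complex) \<Rightarrow> ('b \<times> 'b \<Rightarrow>\<^sub>0 complex)) \<Rightarrow>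
     (('b \<Rightarrow>\<^sub>0 complex) \<Rightarrow> complex) \<Rightarrow> bool" where
  "is_bialgebra \<Delta> \<epsilon> \<longleftrightarrow>
     is_coalgebra \<Delta> \<epsilon> \<and>
     \<Delta> 1 = 1 \<and> (\<forall>x y. \<Delta> (x * y) = \<Delta> x * \<Delta> y) \<and>
     \<epsilon> 1 = 1 \<and> (\<forall>x y. \<epsilon> (x * y) = \<epsilon> x * \<epsilon> y)"

definition is_antipode ::
    "(('b::monoid_add \<Rightarrow>\<^sub>0 complex) \<Rightarrow> ('b \<times> 'b \<Rightarrow>\<^sub>0 complex)) \<Rightarrow>
     (('b \<Rightarrow>\<^sub>0 complex) \<Rightarrow> complex) \<Rightarrow> (('b \<Rightarrow>\<^sub>0 complex) \<Rightarrow> ('b \<Rightarrow>\<^sub>0 complex)) \<Rightarrow> bool" where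
  "is_antipode \<Delta> \<epsilon> S \<longleftrightarrow>
     Vector_Spaces.linear smult smult S \<and>
     (\<forall>x. mult_map (tensor_map S id (\<Delta> x)) = smult (\<epsilon> x) 1) \<and>
     (\<forall>x. mult_map (tensor_map id S (\<Delta> x)) = smult (\<epsilon> x) 1)"

definition is_hopf_algebra ::
    "(('b::monoid_add \<Rightarrow>\<^sub>0 complex) \<Rightarrow> ('b \<times> 'b \<Rightarrow>\<^sub>0 complex)) \<Rightarrow>
     (('b \<Rightarrow>\<^sub>0 complex) \<Rightarrow> complex) \<Rightarrow> bool" where
  "is_hopf_algebra \<Delta> \<epsilon> \<longleftrightarrow> is_bialgebra \<Delta> \<epsilon> \<and> (\<exists>S. is_antipode \<Delta> \<epsilon> S)"

text \<open>A grading of a vector space: it is the direct sum of the subspaces \<open>G n\<close>.\<close>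

definition is_grading :: "(nat \<Rightarrow> ('b \<Rightarrow>\<^sub>0 complex) set) \<Rightarrow> bool" where
  "is_grading G \<longleftrightarrow>
     (\<forall>n. module.subspace smult (G n)) \<and>
     (\<forall>x. \<exists>!f. finite {n. f n \<noteq> 0} \<and> (\<forall>n. f n \<in> G n) \<and> x = (\<Sum>n | f n \<noteq> 0. f n))"

definition tensor_grading ::
    "(nat \<Rightarrow> ('b \<Rightarrow>\<^sub>0 complex) set) \<Rightarrow> nat \<Rightarrow> ('b \<times> 'b \<Rightarrow>\<^sub>0 complex) set" where
  "tensor_grading G n =
     module.span smult {x \<otimes> y | x y. \<exists>i j. i + j = n \<and> x \<in> G i \<and> y \<in> G j}"

definition is_graded_connected_hopf_algebra ::
    "(('b::monoid_add \<Rightarrow>\<^sub>0 complex) \<Rightarrow> ('b \<times> 'b \<Rightarrow>\<^sub>0 complex)) \<Rightarrow>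
     (('b \<Rightarrow>\<^sub>0 complex) \<Rightarrow> complex) \<Rightarrow> (nat \<Rightarrow> ('b \<Rightarrow>\<^sub>0 complex) set) \<Rightarrow> bool" where
  "is_graded_connected_hopf_algebra \<Delta> \<epsilon> G \<longleftrightarrow>
     is_hopf_algebra \<Delta> \<epsilon> \<and>
     is_grading G \<and>
     1 \<in> G 0 \<and>
     (\<forall>m n. \<forall>x\<in>G m. \<forall>y\<in>G n. x * y \<in> G (m + n)) \<and>
     (\<forall>n. \<forall>x\<in>G n. \<Delta> x \<in> tensor_grading G n) \<and>
     (\<forall>n>0. \<forall>x\<in>G n. \<epsilon> x = 0) \<and>
     (\<forall>S. is_antipode \<Delta> \<epsilon> S \<longrightarrow> (\<forall>n. \<forall>x\<in>G n. S x \<in> G n)) \<and>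
     G 0 = module.span smult {1}"

definition cocommutative ::
    "(('b \<Rightarrow>\<^sub>0 complex) \<Rightarrow> ('b \<times> 'b \<Rightarrow>\<^sub>0 complex)) \<Rightarrow> bool" where
  "cocommutative \<Delta> \<longleftrightarrow> (\<forall>x. tensor_swap (\<Delta> x) = \<Delta> x)"


section \<open>Planar binary trees\<close>

text \<open>\<open>Leaf\<close> is the tree \<open>|\<close> of order 0, \<open>Graft t s\<close> is \<open>t \<or> s\<close>.\<close>

datatype pbt = Leaf | Graft pbt pbt

primrec order :: "pbt \<Rightarrow> nat" where
  "order Leaf = 0"
| "order (Graft t s) = order t + order s + 1"

abbreviation VV :: "pbt \<Rightarrow> pbt" where
  "VV t \<equiv> Graft Leaf t"

text \<open>The monoid operation \<open>+\<close> on trees is the over product \<open>/\<close>, so \<open>*\<close> on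
  \<open>pbt \<Rightarrow>\<^sub>0 complex\<close> and on its tensor square is the over product as well.\<close>

instantiation pbt :: monoid_add
begin

definition zero_pbt :: pbt where "0 = Leaf"

primrec plus_pbt :: "pbt \<Rightarrow> pbt \<Rightarrow> pbt" where
  "t + Leaf = t"
| "t + Graft sl sr = Graft (t + sl) sr"

instance
proof
  fix a b c :: pbt
  show "a + b + c = a + (b + c)" by (induction c) auto
  show "0 + a = a" by (induction a) (auto simp: zero_pbt_def)
  show "a + 0 = a" by (simp add: zero_pbt_def)
qed

end

definition V_lin :: "(pbt \<Rightarrow>\<^sub>0 complex) \<Rightarrow> (pbt \<Rightarrow>\<^sub>0 complex)" where
  "V_lin = lin_ext (\<lambda>t. basis (VV t))"

text \<open>\<open>Delta_t\<close> and \<open>delta_t\<close> are the maps \<open>\<Delta>\<close>-tilde and \<open>\<delta>\<close>-tilde on trees.  The values on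
  \<open>V(s)\<close> are inserted into the recursion for \<open>t \<or> s\<close>; the defining equations as usually
  stated are \<open>delta_t_V\<close>, \<open>Delta_t_V\<close>, \<open>Delta_t_Graft\<close> and \<open>delta_t_Graft\<close>.\<close>

fun Delta_t :: "pbt \<Rightarrow> (pbt \<times> pbt \<Rightarrow>\<^sub>0 complex)"
  and delta_t :: "pbt \<Rightarrow> (pbt \<times> pbt \<Rightarrow>\<^sub>0 complex)" where
  "Delta_t Leaf = basis (Leaf, Leaf)"
| "Delta_t (Graft t s) =
     Delta_t t * (basis (Leaf, VV s) + tensor_map V_lin id (delta_t s))"
| "delta_t Leaf = basis (Leaf, Leaf)"
| "delta_t (Graft t s) = Delta_t t * tensor_map V_lin id (delta_t s)"

lemma basis_Leaf_Leaf: "basis (Leaf, Leaf) = 1"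
  by (simp flip: zero_pbt_def zero_prod_def)

lemma delta_t_V: "delta_t (VV t) = tensor_map V_lin id (delta_t t)"
  and Delta_t_V: "Delta_t (VV t) = basis (Leaf, VV t) + delta_t (VV t)"
  and Delta_t_Graft: "Delta_t (Graft t s) = Delta_t t * Delta_t (VV s)"
  and delta_t_Graft: "delta_t (Graft t s) = Delta_t t * delta_t (VV s)"
  by (simp_all add: basis_Leaf_Leaf)

definition delta_tilde :: "(pbt \<Rightarrow>\<^sub>0 complex) \<Rightarrow> (pbt \<times> pbt \<Rightarrow>\<^sub>0 complex)" where
  "delta_tilde = lin_ext delta_t"

definition Delta_tilde :: "(pbt \<Rightarrow>\<^sub>0 complex) \<Rightarrow> (pbt \<times> pbt \<Rightarrow>\<^sub>0 complex)" where
  "Delta_tilde = lin_ext Delta_t"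


section \<open>The polynomial algebra on the trees \<open>V(t)\<close>\<close>

text \<open>The multiset \<open>{#t\<^sub>1, \<dots>, t\<^sub>n#}\<close> stands for the commutative monomial \<open>V(t\<^sub>1) \<cdots> V(t\<^sub>n)\<close>.\<close>

type_synonym H_alpha = "pbt multiset \<Rightarrow>\<^sub>0 complex"

text \<open>Abelianization: \<open>t \<or> s = t / V(s)\<close> is sent to \<open>\<pi>(t) V(s)\<close>.\<close>

primrec abelian_monom :: "pbt \<Rightarrow> pbt multiset" where
  "abelian_monom Leaf = {#}"
| "abelian_monom (Graft t s) = abelian_monom t + {#s#}"

definition ab_proj :: "(pbt \<Rightarrow>\<^sub>0 complex) \<Rightarrow> H_alpha" where
  "ab_proj = lin_ext (\<lambda>t. basis (abelian_monom t))"

lemma abelian_monom_over: "abelian_monom (t + s) = abelian_monom t + abelian_monom s"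
  by (induction s) auto

definition Delta_alpha :: "H_alpha \<Rightarrow> (pbt multiset \<times> pbt multiset \<Rightarrow>\<^sub>0 complex)" where
  "Delta_alpha =
     lin_ext (\<lambda>M. \<Prod>t\<in>#M. tensor_map ab_proj ab_proj (Delta_tilde (basis (VV t))))"

text \<open>The counit is the coefficient of the unit, i.e. the algebra morphism to \<open>\<complex>\<close> vanishing on
  all generators \<open>V(t)\<close>.\<close>

definition eps_alpha :: "H_alpha \<Rightarrow> complex" where
  "eps_alpha x = Poly_Mapping.lookup x {#}"


section \<open>The free associative algebra on trees, with \<open>|\<close> identified with the unit\<close>

text \<open>Identifying \<open>|\<close> with the unit leaves the free algebra on the trees different from \<open>|\<close>,
  whose basis consists of the words in these trees.\<close>

typedef tree_word = "{w :: pbt list. Leaf \<notin> set w}"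
  morphisms letters Abs_tree_word
  by (rule exI[of _ "[]"]) simp

instantiation tree_word :: monoid_add
begin

definition zero_tree_word :: tree_word where "0 = Abs_tree_word []"

definition plus_tree_word :: "tree_word \<Rightarrow> tree_word \<Rightarrow> tree_word" where
  "v + w = Abs_tree_word (letters v @ letters w)"

instance
proof
  fix a b c :: tree_word
  note [simp] = zero_tree_word_def plus_tree_word_def Abs_tree_word_inverse letters_inverse
    letters[simplified]
  show "a + b + c = a + (b + c)" "0 + a = a" "a + 0 = a" by simp_all
qed

end

type_synonym H_e = "tree_word \<Rightarrow>\<^sub>0 complex"

definition word_of :: "pbt \<Rightarrow> tree_word" where
  "word_of t = Abs_tree_word (if t = Leaf then [] else [t])"

definition embed_e :: "(pbt \<Rightarrow>\<^sub>0 complex) \<Rightarrow> H_e" where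
  "embed_e = lin_ext (\<lambda>t. basis (word_of t))"

text \<open>The pruning coproduct of a tree, with values in the tensor square of the span of trees.\<close>

primrec prune_tree :: "pbt \<Rightarrow> (pbt \<times> pbt \<Rightarrow>\<^sub>0 complex)" where
  "prune_tree Leaf = basis (Leaf, Leaf)"
| "prune_tree (Graft t s) =
     basis (Leaf, Graft t s) + lin_ext (\<lambda>(s1, s2). basis (Graft t s1, s2)) (prune_tree s)"

definition Delta_e :: "H_e \<Rightarrow> (tree_word \<times> tree_word \<Rightarrow>\<^sub>0 complex)" where
  "Delta_e =
     lin_ext (\<lambda>w. \<Prod>t\<leftarrow>letters w. tensor_map embed_e embed_e (prune_tree t))"

definition eps_e :: "H_e \<Rightarrow> complex" where
  "eps_e x = Poly_Mapping.lookup x 0"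

definition coaction_e :: "H_e \<Rightarrow> (tree_word \<times> pbt multiset \<Rightarrow>\<^sub>0 complex)" where
  "coaction_e =
     lin_ext (\<lambda>w. \<Prod>t\<leftarrow>letters w. tensor_map embed_e ab_proj (delta_tilde (basis t)))"


section \<open>The smash coproduct\<close>

text \<open>The algebra structure of \<open>H_qed\<close> is the library one; see \<open>tensor_mult\<close>.\<close>

type_synonym qed_monom = "pbt multiset \<times> tree_word"
type_synonym H_qed = "qed_monom \<Rightarrow>\<^sub>0 complex"

text \<open>\<open>(a\<^sub>1 \<otimes> a\<^sub>2) \<otimes> ((b\<^sub>e \<otimes> b\<^sub>\<alpha>) \<otimes> b\<^sub>2) \<mapsto> (a\<^sub>1 \<otimes> b\<^sub>e) \<otimes> (a\<^sub>2 b\<^sub>\<alpha> \<otimes> b\<^sub>2)\<close>\<close>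

definition qed_combine ::
    "((pbt multiset \<times> pbt multiset) \<times> (tree_word \<times> pbt multiset) \<times> tree_word \<Rightarrow>\<^sub>0 complex) \<Rightarrow>
     (qed_monom \<times> qed_monom \<Rightarrow>\<^sub>0 complex)" where
  "qed_combine =
     lin_ext (\<lambda>((a1, a2), (be, ba), b2).
       (basis a1 \<otimes> basis be) \<otimes> ((basis a2 * basis ba) \<otimes> basis b2))"

definition Delta_qed :: "H_qed \<Rightarrow> (qed_monom \<times> qed_monom \<Rightarrow>\<^sub>0 complex)" where
  "Delta_qed =
     lin_ext (\<lambda>(a, b).
       qed_combine (Delta_alpha (basis a) \<otimes> tensor_map coaction_e id (Delta_e (basis b))))"

definition eps_qed :: "H_qed \<Rightarrow> complex" where
  "eps_qed x = (\<Sum>(a, b)\<in>Poly_Mapping.keys x.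
     Poly_Mapping.lookup x (a, b) * (eps_alpha (basis a) * eps_e (basis b)))"

text \<open>A variable \<open>t\<close> of \<open>H_alpha\<close> is the tree \<open>V(t)\<close>, hence has degree \<open>order (V(t))\<close>.\<close>

fun qed_degree :: "qed_monom \<Rightarrow> nat" where
  "qed_degree (M, w) = (\<Sum>t\<in>#M. order (VV t)) + (\<Sum>t\<leftarrow>letters w. order t)"

definition qed_component :: "nat \<Rightarrow> H_qed set" where
  "qed_component n = module.span smult {basis m | m. qed_degree m = n}"

lemma Delta_qed_tensor:
  "Delta_qed (a \<otimes> b) = qed_combine (Delta_alpha a \<otimes> tensor_map coaction_e id (Delta_e b))"
proof -
  note lin = tensor_add_left tensor_add_right tensor_smult_left tensor_smult_right
    lin_ext_add lin_ext_smult
  have z: "lin_ext f 0 = 0" for f :: "'a \<Rightarrow> ('b \<Rightarrow>\<^sub>0 complex)"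
    by (simp add: lin_ext_def)
  have z': "0 \<otimes> y = 0" "x \<otimes> 0 = 0" for x :: "'c \<Rightarrow>\<^sub>0 complex" and y :: "'d \<Rightarrow>\<^sub>0 complex"
    by (auto simp: tensor_def)
  show ?thesis
  proof (induction a rule: vector_induct)
    case (basis m)
    show ?case
    proof (induction b rule: vector_induct)
      case (basis w)
      show ?case unfolding tensor_basis Delta_qed_def by (simp only: lin_ext_basis prod.case)
    qed (simp_all add: Delta_qed_def qed_combine_def Delta_e_def tensor_map_def lin z z')
  qed (simp_all add: Delta_qed_def qed_combine_def Delta_alpha_def lin z z')
qed

lemma eps_qed_tensor: "eps_qed (a \<otimes> b) = eps_alpha a * eps_e b"
proof -
  have "Poly_Mapping.lookup (basis m) {#} = (if m = {#} then 1 else 0)"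
    "Poly_Mapping.lookup (basis w) 0 = (if w = 0 then 1 else 0)" for m :: "pbt multiset" and w :: tree_word
    by (auto simp: lookup_single when_def)
  hence "eps_qed x = (\<Sum>p\<in>Poly_Mapping.keys x. if p = ({#}, 0) then Poly_Mapping.lookup x p else 0)" for x
    unfolding eps_qed_def eps_alpha_def eps_e_def by (intro sum.cong refl) (auto split: if_splits prod.splits)
  hence "eps_qed x = Poly_Mapping.lookup x ({#}, 0)" for x
    by (auto simp: in_keys_iff)
  thus ?thesis by (simp add: lookup_tensor eps_alpha_def eps_e_def)
qed

end

theory Submission
  imports Defs
begin

text \<open>
  Every identity in the Hopf algebra axioms for the smash coproduct reduces to an identity between
  linear maps on trees.  The reduction rests on two observations.  First, \<open>H_qed\<close> is generated
  as an algebra by the images \<open>\<alpha>(t) = \<pi>(t) \<otimes> 1\<close> and \<open>\<beta>(t) = 1 \<otimes> t\<close> of trees.  Second,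
  \<open>Delta_qed\<close> is an algebra morphism (\<open>qed_coprod_plus\<close>): \<open>Delta_alpha\<close>, \<open>Delta_e\<close> and the
  coaction are, and moving the factors \<open>b\<^sub>\<alpha>\<close> next to \<open>a\<^sub>2\<close> is multiplicative because \<open>H_alpha\<close>
  is commutative.  So both sides of coassociativity and of the counit laws are algebra morphisms,
  and it suffices to compare them on generators (\<open>qed_monom_eqI\<close>), where (in Sweedler notation)
  \<open>\<Delta>(\<alpha>(t)) = \<Sum> \<alpha>(t\<^sub>1) \<otimes> \<alpha>(t\<^sub>2)\<close> for \<open>Delta_t t = \<Sum> t\<^sub>1 \<otimes> t\<^sub>2\<close>, and
  \<open>\<Delta>(\<beta>(t)) = \<Sum> \<beta>(x) \<otimes> \<alpha>(x') \<beta>(q)\<close> for \<open>prune_tree t = \<Sum> p \<otimes> q\<close> and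
  \<open>delta_t p = \<Sum> x \<otimes> x'\<close>.

  On \<open>\<alpha>(t)\<close>, coassociativity is that of \<open>Delta_t\<close>.  On \<open>\<beta>(t)\<close> it follows from three facts
  about trees: \<open>delta_t\<close> is a coaction of \<open>Delta_t\<close>, pruning is coassociative, and pruning is
  compatible with the coaction (\<open>coassoc_trees\<close>, \<open>prune_coassoc\<close>, \<open>prune_delta\<close>).  Each is an
  induction along the recursive definitions, and each already holds over the noncommutative over
  product, before passing to the quotient \<open>H_alpha\<close>.

  The rest is a general property of connected graded bialgebras: the degree of basis elements is
  respected by the coproduct and vanishes on the unit only, so the geometric series
  \<open>\<Sum>\<^sub>k (u\<epsilon> - id)\<^sup>k\<close> for the convolution product is locally finite and gives the antipode
  (\<open>is_antipode_antipode\<close>), and the equation that defines an antipode determines it degree by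
  degree (\<open>antipode_homog\<close>).
\<close>

section \<open>Linear extension as a monad\<close>

text \<open>
  Linear maps out of a space with a basis are the Kleisli arrows of the free vector space monad, and
  \<open>p \<bind> (\<lambda>(a, b). f a b)\<close> reads as Sweedler's \<open>\<Sum> f a b\<close> for \<open>p = \<Sum> a \<otimes> b\<close>.
  Rewriting with the monad laws brings composites of coproducts to a normal form, unique up to the
  order of independent summations (\<open>lin_ext_commute\<close>).
\<close>

abbreviation bind_lin :: "('a \<Rightarrow>\<^sub>0 complex) \<Rightarrow> ('a \<Rightarrow> ('b \<Rightarrow>\<^sub>0 complex)) \<Rightarrow> ('b \<Rightarrow>\<^sub>0 complex)"
    (infixl \<open>\<bind>\<close> 66) where
  "p \<bind> f \<equiv> lin_ext f p"

lemma smult_zero [simp]: "smult c 0 = 0" "smult 0 p = 0"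
  and smult_one [simp]: "smult 1 p = p"
  and smult_smult [simp]: "smult c (smult d p) = smult (c * d) p"
  and smult_add: "smult c (p + q) = smult c p + smult c q"
  and smult_minus_one [simp]: "smult (- 1) p = - p"
  by (auto intro!: poly_mapping_eqI simp: lookup_add algebra_simps)

lemma lin_ext_zero [simp]: "lin_ext f 0 = 0"
  by (simp add: lin_ext_def)

lemma lin_ext_cong:
  "(\<And>b. b \<in> Poly_Mapping.keys p \<Longrightarrow> f b = g b) \<Longrightarrow> lin_ext f p = lin_ext g p"
  by (simp add: lin_ext_def)

lemma lin_ext_bind: "lin_ext f (lin_ext g p) = lin_ext (\<lambda>b. lin_ext f (g b)) p"
  by (induction p rule: vector_induct) (simp_all add: lin_ext_add lin_ext_smult)

lemma lin_ext_return [simp]: "lin_ext basis p = p"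
  by (induction p rule: vector_induct) (simp_all add: lin_ext_add lin_ext_smult)

lemma lin_ext_fun_zero [simp]: "lin_ext (\<lambda>b. 0) p = 0"
  by (induction p rule: vector_induct) (simp_all add: lin_ext_add lin_ext_smult)

lemma lin_ext_fun_add: "lin_ext (\<lambda>b. f b + g b) p = lin_ext f p + lin_ext g p"
  by (induction p rule: vector_induct) (simp_all add: lin_ext_add lin_ext_smult smult_add)

lemma lin_ext_fun_smult: "lin_ext (\<lambda>b. smult c (f b)) p = smult c (lin_ext f p)"
  by (induction p rule: vector_induct)
    (simp_all add: lin_ext_add lin_ext_smult smult_add mult.commute)

lemma lin_ext_fun_minus: "lin_ext (\<lambda>b. - f b) p = - lin_ext f p"
  by (metis (no_types, lifting) add_eq_0_iff lin_ext_cong lin_ext_fun_add lin_ext_fun_zero)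

lemma lin_ext_fun_diff: "lin_ext (\<lambda>b. f b - g b) p = lin_ext f p - lin_ext g p"
  using lin_ext_fun_add[of f "\<lambda>b. - g b" p] by (simp add: lin_ext_fun_minus)

lemma lin_ext_fun_sum: "lin_ext (\<lambda>b. \<Sum>i\<in>I. f i b) p = (\<Sum>i\<in>I. lin_ext (f i) p)"
  by (induction I rule: infinite_finite_induct) (simp_all add: lin_ext_fun_add)

lemma lin_ext_commute:
  "lin_ext (\<lambda>a. lin_ext (\<lambda>b. f a b) q) p = lin_ext (\<lambda>b. lin_ext (\<lambda>a. f a b) p) q"
  by (induction p rule: vector_induct)
    (simp_all add: lin_ext_add lin_ext_smult lin_ext_fun_add lin_ext_fun_smult)

lemma one_basis: "1 = basis 0"
  by simp

lemma lin_ext_one [simp]: "lin_ext f 1 = f 0"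
  using lin_ext_basis[of f 0] by simp

lemma one_pair: "1 = basis (0, 0)"
  by (simp flip: zero_prod_def)

lemma tensor_bind: "p \<otimes> q = p \<bind> (\<lambda>a. q \<bind> (\<lambda>b. basis (a, b)))"
proof -
  have z: "0 \<otimes> y = 0" "x \<otimes> 0 = 0" for x :: "'c \<Rightarrow>\<^sub>0 complex" and y :: "'d \<Rightarrow>\<^sub>0 complex"
    by (auto simp: tensor_def)
  note dist = tensor_add_left tensor_add_right tensor_smult_left tensor_smult_right z
    lin_ext_add lin_ext_smult
  show ?thesis
  proof (induction p rule: vector_induct)
    case (basis a)
    show ?case by (induction q rule: vector_induct) (simp_all add: dist)
  qed (simp_all add: dist)
qed

lemma mult_bind: "p * q = p \<bind> (\<lambda>a. q \<bind> (\<lambda>b. basis (a + b)))"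
proof -
  note dist = smult_mult_left smult_mult_right ring_distribs lin_ext_add lin_ext_smult
  show ?thesis
  proof (induction p rule: vector_induct)
    case (basis a)
    show ?case by (induction q rule: vector_induct) (simp_all add: dist mult_single)
  qed (simp_all add: dist)
qed

lemma lin_ext_times_left: "lin_ext f p * q = lin_ext (\<lambda>b. f b * q) p"
  by (induction p rule: vector_induct)
    (simp_all add: lin_ext_add lin_ext_smult smult_mult_left ring_distribs)

lemma lin_ext_times_right: "q * lin_ext f p = lin_ext (\<lambda>b. q * f b) p"
  by (induction p rule: vector_induct)
    (simp_all add: lin_ext_add lin_ext_smult smult_mult_right ring_distribs)

lemma basis_mult: "basis a * basis b = basis (a + b)"
  by (simp add: mult_single)

text \<open>
  The second factor ranges over the image of \<open>r\<close> only: this covers maps such as \<open>delta_t\<close>,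
  which satisfy a product rule only when the right factor differs from \<open>Leaf\<close>.
\<close>

lemma lin_ext_mult_image:
  assumes "\<And>a x. h (a + r x) = g a * k x"
  shows "lin_ext h (p * lin_ext (\<lambda>x. basis (r x)) q) = lin_ext g p * lin_ext k q"
proof -
  have "lin_ext h (p * lin_ext (\<lambda>x. basis (r x)) q) = p \<bind> (\<lambda>a. q \<bind> (\<lambda>x. g a * k x))"
    by (simp add: mult_bind[of p] lin_ext_bind assms)
  thus ?thesis
    by (subst lin_ext_times_left) (simp only: lin_ext_times_right)
qed

lemma lin_ext_mult:
  assumes "\<And>a b. g (a + b) = g a * g b"
  shows "lin_ext g (p * q) = lin_ext g p * lin_ext g q"
  using lin_ext_mult_image[of g id g g p q] assms by simp

lemma tensor_map_lin_ext:
  "tensor_map (lin_ext f) (lin_ext g) p =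
     p \<bind> (\<lambda>(a, b). f a \<bind> (\<lambda>a'. g b \<bind> (\<lambda>b'. basis (a', b'))))"
  by (simp add: tensor_map_def tensor_bind)

lemma tensor_map_id:
  "tensor_map (lin_ext f) id p = p \<bind> (\<lambda>(a, b). f a \<bind> (\<lambda>a'. basis (a', b)))"
  "tensor_map id (lin_ext g) p = p \<bind> (\<lambda>(a, b). g b \<bind> (\<lambda>b'. basis (a, b')))"
  by (simp_all add: tensor_map_def tensor_bind)

section \<open>Homogeneous vectors\<close>

definition homog :: "('a \<Rightarrow> nat) \<Rightarrow> nat \<Rightarrow> ('a \<Rightarrow>\<^sub>0 complex) \<Rightarrow> bool" where
  "homog d n p \<longleftrightarrow> (\<forall>k\<in>Poly_Mapping.keys p. d k = n)"

lemma homog_basis [simp]: "homog d n (Poly_Mapping.single b c) \<longleftrightarrow> c = 0 \<or> d b = n"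
  by (simp add: homog_def)

lemma homog_zero [simp]: "homog d n 0"
  by (simp add: homog_def)

lemma homog_lookup: "homog d n p \<Longrightarrow> d k \<noteq> n \<Longrightarrow> Poly_Mapping.lookup p k = 0"
  by (metis homog_def in_keys_iff)

lemma homog_add: "homog d n p \<Longrightarrow> homog d n q \<Longrightarrow> homog d n (p + q)"
  using keys_add[of p q] by (auto simp: homog_def)

lemma homog_smult: "homog d n p \<Longrightarrow> homog d n (smult c p)"
  by (auto simp: homog_def in_keys_iff)

lemma homog_sum: "(\<And>i. i \<in> I \<Longrightarrow> homog d n (p i)) \<Longrightarrow> homog d n (\<Sum>i\<in>I. p i)"
  by (induction I rule: infinite_finite_induct) (auto intro: homog_add)

lemma homog_bind:
  assumes "homog d n p" "\<And>k. d k = n \<Longrightarrow> homog e m (f k)"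
  shows "homog e m (p \<bind> f)"
  unfolding lin_ext_def using assms by (auto simp: homog_def[of d] intro!: homog_sum homog_smult)

lemma homog_mult:
  assumes "homog d n p" "homog d m q" "\<And>a b. d (a + b) = d a + d b"
  shows "homog d (n + m) (p * q)"
  unfolding mult_bind by (intro homog_bind[OF assms(1)] homog_bind[OF assms(2)]) (simp add: assms(3))

abbreviation pair_degree :: "('a \<Rightarrow> nat) \<Rightarrow> 'a \<times> 'a \<Rightarrow> nat" where
  "pair_degree d \<equiv> \<lambda>x. d (fst x) + d (snd x)"


text \<open>
  \<open>homog d n\<close> describes the spans of basis elements through the support of a vector, and the tensor
  grading through the sum of the degrees.
\<close>

lemma span_basis: "module.span smult {basis m | m. d m = n} = {p. homog d n p}"
proof -
  interpret vector_space "smult :: complex \<Rightarrow> ('a \<Rightarrow>\<^sub>0 complex) \<Rightarrow> _" by (rule vector_space_smult)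
  have "subspace {p. homog d n p}"
    unfolding subspace_def by (auto intro: homog_add homog_smult)
  moreover have "p \<in> span {basis m | m. d m = n}" if "homog d n p" for p
  proof -
    have "p = (\<Sum>k\<in>Poly_Mapping.keys p. smult (Poly_Mapping.lookup p k) (basis k))"
      using lin_ext_return[of p] unfolding lin_ext_def by simp
    also have "\<dots> \<in> span {basis m | m. d m = n}"
      using that by (intro span_sum span_scale span_base) (auto simp: homog_def)
    finally show ?thesis .
  qed
  ultimately show ?thesis by (intro equalityI span_minimal) auto
qed

lemma is_grading_homog: "is_grading (\<lambda>n. {p. homog d n p})"
proof -
  interpret vector_space "smult :: complex \<Rightarrow> ('a \<Rightarrow>\<^sub>0 complex) \<Rightarrow> _" by (rule vector_space_smult)
  have sub: "subspace {p. homog d n p}" for n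
    unfolding subspace_def by (auto intro: homog_add homog_smult)
  have lookup_sum_homog: "Poly_Mapping.lookup (\<Sum>n | f n \<noteq> 0. f n) k = Poly_Mapping.lookup (f (d k)) k"
    if "finite {n. f n \<noteq> 0}" "\<And>n. homog d n (f n)" for f k
  proof -
    have "Poly_Mapping.lookup (\<Sum>n | f n \<noteq> 0. f n) k = (\<Sum>n | f n \<noteq> 0. if n = d k then Poly_Mapping.lookup (f (d k)) k else 0)"
      unfolding lookup_sum using that(2) by (intro sum.cong) (auto intro: homog_lookup)
    thus ?thesis using that(1) by auto
  qed
  have "\<exists>!f. finite {n. f n \<noteq> 0} \<and> (\<forall>n. homog d n (f n)) \<and> x = (\<Sum>n | f n \<noteq> 0. f n)" for x
  proof (rule ex_ex1I)
    define f where "f n = x \<bind> (\<lambda>k. if d k = n then basis k else 0)" for n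
    have h: "homog d n (f n)" for n
      unfolding f_def lin_ext_def by (intro homog_sum homog_smult) auto
    have l: "Poly_Mapping.lookup (f n) k = (if d k = n then Poly_Mapping.lookup x k else 0)" for n k
      unfolding f_def by (induction x rule: vector_induct)
        (auto simp: lin_ext_add lin_ext_smult lookup_add lookup_single when_def)
    have "{n. f n \<noteq> 0} \<subseteq> d ` Poly_Mapping.keys x"
    proof
      fix n assume "n \<in> {n. f n \<noteq> 0}"
      then obtain k where "Poly_Mapping.lookup (f n) k \<noteq> 0" by (metis lookup_zero mem_Collect_eq poly_mapping_eqI)
      thus "n \<in> d ` Poly_Mapping.keys x" by (auto simp: l in_keys_iff split: if_splits)
    qed
    hence fin: "finite {n. f n \<noteq> 0}" by (rule finite_subset) simp
    have "x = (\<Sum>n | f n \<noteq> 0. f n)"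
      by (rule poly_mapping_eqI) (simp add: lookup_sum_homog[OF fin h] l)
    thus "\<exists>f. finite {n. f n \<noteq> 0} \<and> (\<forall>n. homog d n (f n)) \<and> x = (\<Sum>n | f n \<noteq> 0. f n)"
      using fin h by blast
  next
    fix f g
    assume f: "finite {n. f n \<noteq> 0} \<and> (\<forall>n. homog d n (f n)) \<and> x = (\<Sum>n | f n \<noteq> 0. f n)"
      and g: "finite {n. g n \<noteq> 0} \<and> (\<forall>n. homog d n (g n)) \<and> x = (\<Sum>n | g n \<noteq> 0. g n)"
    have "Poly_Mapping.lookup (f n) k = Poly_Mapping.lookup (g n) k" for n k
      using lookup_sum_homog[of f k] lookup_sum_homog[of g k] f g homog_lookup[of d n _ k]
      by (cases "d k = n") metis+
    thus "f = g" by (intro ext poly_mapping_eqI)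
  qed
  thus ?thesis unfolding is_grading_def using sub by simp
qed

lemma tensor_grading_homog:
  "tensor_grading (\<lambda>n. {p. homog d n p}) n = {p. homog (pair_degree d) n p}"
proof -
  interpret vector_space "smult :: complex \<Rightarrow> ('a \<times> 'a \<Rightarrow>\<^sub>0 complex) \<Rightarrow> _" by (rule vector_space_smult)
  let ?S = "{x \<otimes> y | x y. \<exists>i j. i + j = n \<and> x \<in> {p. homog d i p} \<and> y \<in> {p. homog d j p}}"
  have 1: "?S \<subseteq> {p. homog (pair_degree d) n p}"
  proof clarify
    fix x y i j assume "homog d i x" "homog d j y"
    thus "homog (pair_degree d) (i + j) (x \<otimes> y)"
      unfolding tensor_bind by (auto intro!: homog_bind[of d i x] homog_bind[of d j y])
  qed
  have 2: "subspace {p. homog (pair_degree d) n p}"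
    unfolding subspace_def by (auto intro: homog_add homog_smult)
  have "{basis m | m. pair_degree d m = n} \<subseteq> ?S"
  proof clarify
    fix a b assume "n = pair_degree d (a, b)"
    show "\<exists>x y. basis (a, b) = x \<otimes> y \<and> (\<exists>i j. i + j = pair_degree d (a, b) \<and> x \<in> {p. homog d i p} \<and> y \<in> {p. homog d j p})"
      by (rule exI[of _ "basis a"], rule exI[of _ "basis b"]) auto
  qed
  note 3 = span_mono[OF this]
  from 1 2 have "span ?S \<subseteq> {p. homog (pair_degree d) n p}" by (rule span_minimal)
  with 3 show ?thesis
    unfolding tensor_grading_def by (simp only: span_basis)
qed

section \<open>Antipodes of connected graded bialgebras\<close>

lemma mult_map_tensor: "mult_map (p \<otimes> q) = p * q"
  by (simp add: mult_map_def tensor_bind lin_ext_bind mult_bind[of p q] basis_mult)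

lemma mult_map_bind: "mult_map (p \<bind> f) = p \<bind> (\<lambda>x. mult_map (f x))"
  by (simp add: mult_map_def lin_ext_bind)

text \<open>
  The coproduct is given by its values \<open>D\<close> on the basis, and the counit is the coefficient of the unit.
\<close>

locale connected_coproduct =
  fixes D :: "'b::monoid_add \<Rightarrow> ('b \<times> 'b \<Rightarrow>\<^sub>0 complex)" and d :: "'b \<Rightarrow> nat"
  assumes coassoc: "D b \<bind> (\<lambda>(a, b). D a \<bind> (\<lambda>(c, d). basis (c, d, b))) =
     D b \<bind> (\<lambda>(a, b). D b \<bind> (\<lambda>(c, d). basis (a, c, d)))"
  and counit_l: "D b \<bind> (\<lambda>(a, b). smult (of_bool (a = 0)) (basis b)) = basis b"
  and counit_r: "D b \<bind> (\<lambda>(a, b). smult (of_bool (b = 0)) (basis a)) = basis b"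
  and homog_D: "homog (pair_degree d) (d b) (D b)"
  and d_eq_0_iff: "d b = 0 \<longleftrightarrow> b = 0"
begin

text \<open>Convolution of linear maps that are given by their values on the basis.\<close>

definition conv :: "('b \<Rightarrow> ('b \<Rightarrow>\<^sub>0 complex)) \<Rightarrow> ('b \<Rightarrow> ('b \<Rightarrow>\<^sub>0 complex)) \<Rightarrow> 'b \<Rightarrow> ('b \<Rightarrow>\<^sub>0 complex)" where
  "conv F G b = D b \<bind> (\<lambda>(x, y). F x * G y)"

lemma conv_assoc: "conv (conv F G) H = conv F (conv G H)"
proof
  fix b
  let ?T = "\<lambda>(x, y, z). F x * G y * H z"
  have "conv (conv F G) H b = (D b \<bind> (\<lambda>(a, b). D a \<bind> (\<lambda>(c, d). basis (c, d, b)))) \<bind> ?T"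
    by (simp add: conv_def lin_ext_bind case_prod_beta' lin_ext_times_left)
  also have "\<dots> = conv F (conv G H) b"
    unfolding coassoc by (simp add: conv_def lin_ext_bind case_prod_beta' lin_ext_times_right mult.assoc)
  finally show "conv (conv F G) H b = conv F (conv G H) b" .
qed

definition unit_counit :: "'b \<Rightarrow> ('b \<Rightarrow>\<^sub>0 complex)" where
  "unit_counit b = smult (of_bool (b = 0)) 1"

lemma conv_unit_left: "conv unit_counit F b = F b"
proof -
  have "conv unit_counit F b = (D b \<bind> (\<lambda>(a, b). smult (of_bool (a = 0)) (basis b))) \<bind> F"
    by (simp add: conv_def unit_counit_def lin_ext_bind case_prod_beta' lin_ext_smult smult_mult_left)
  thus ?thesis by (simp add: counit_l)
qed

lemma conv_unit_right: "conv F unit_counit b = F b"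
proof -
  have "conv F unit_counit b = (D b \<bind> (\<lambda>(a, b). smult (of_bool (b = 0)) (basis a))) \<bind> F"
    by (simp add: conv_def unit_counit_def lin_ext_bind case_prod_beta' lin_ext_smult smult_mult_right)
  thus ?thesis by (simp add: counit_r)
qed

definition unit_counit_minus_id :: "'b \<Rightarrow> ('b \<Rightarrow>\<^sub>0 complex)" where
  "unit_counit_minus_id b = unit_counit b - basis b"

primrec conv_pow :: "nat \<Rightarrow> 'b \<Rightarrow> ('b \<Rightarrow>\<^sub>0 complex)" where
  "conv_pow 0 = unit_counit"
| "conv_pow (Suc k) = conv unit_counit_minus_id (conv_pow k)"

lemma conv_pow_Suc_right: "conv (conv_pow k) unit_counit_minus_id = conv_pow (Suc k)"
proof (induction k)
  case 0
  show ?case by (simp add: fun_eq_iff conv_unit_left conv_unit_right)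
qed (simp add: conv_assoc)

lemma conv_cong:
  assumes "\<And>x y. d x \<le> d b \<Longrightarrow> d y \<le> d b \<Longrightarrow> d x + d y = d b \<Longrightarrow> F x * G y = F' x * G' y"
  shows "conv F G b = conv F' G' b"
  unfolding conv_def using homog_D[of b] assms by (intro lin_ext_cong) (auto simp: homog_def)

text \<open>
  \<open>u\<epsilon> - id\<close> kills the unit, hence only splittings whose first part has positive degree
  contribute, and each convolution factor lowers the degree left to the others.
\<close>

lemma conv_pow_eq_0: "d b < k \<Longrightarrow> conv_pow k b = 0"
proof (induction k arbitrary: b)
  case (Suc k)
  have "unit_counit_minus_id x * conv_pow k y = 0" if "d x + d y = d b" for x y
  proof (cases "x = 0")
    case True
    thus ?thesis by (simp add: unit_counit_minus_id_def unit_counit_def)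
  next
    case False
    hence "d y < k" using Suc.prems that d_eq_0_iff[of x] by linarith
    thus ?thesis by (simp add: Suc.IH)
  qed
  hence "conv unit_counit_minus_id (conv_pow k) b = conv (\<lambda>_. 0) (conv_pow k) b" by (intro conv_cong) auto
  thus ?case by (simp add: conv_def case_prod_beta')
qed simp

definition antipode :: "'b \<Rightarrow> ('b \<Rightarrow>\<^sub>0 complex)" where
  "antipode b = (\<Sum>k\<le>d b. conv_pow k b)"

lemma antipode_eq: "d b \<le> n \<Longrightarrow> antipode b = (\<Sum>k\<le>n. conv_pow k b)"
  unfolding antipode_def by (intro sum.mono_neutral_left) (auto intro: conv_pow_eq_0)

lemma basis_eq: "basis b = unit_counit b - unit_counit_minus_id b"
  by (simp add: unit_counit_minus_id_def)

lemma telescope: "(\<Sum>k\<le>n. conv_pow k b - conv_pow (Suc k) b) = unit_counit b" if "n \<ge> d b"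
  using that conv_pow_eq_0[of b "Suc n"] sum_telescope[of "\<lambda>k. conv_pow k b" n]
  by (simp del: conv_pow.simps(2))

lemma conv_antipode_right: "conv basis antipode b = unit_counit b"
proof -
  have "conv basis antipode b = conv basis (\<lambda>x. \<Sum>k\<le>d b. conv_pow k x) b"
    by (intro conv_cong) (metis antipode_eq)
  also have "\<dots> = (\<Sum>k\<le>d b. conv basis (conv_pow k) b)"
    by (simp add: conv_def sum_distrib_left case_prod_beta' lin_ext_fun_sum)
  also have "\<dots> = (\<Sum>k\<le>d b. conv_pow k b - conv_pow (Suc k) b)"
  proof (rule sum.cong[OF refl])
    fix k
    have "conv basis (conv_pow k) b = conv unit_counit (conv_pow k) b - conv unit_counit_minus_id (conv_pow k) b"
      unfolding conv_def basis_eq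
      by (simp add: left_diff_distrib case_prod_beta' lin_ext_fun_diff)
    thus "conv basis (conv_pow k) b = conv_pow k b - conv_pow (Suc k) b"
      by (simp add: conv_unit_left)
  qed
  finally show ?thesis by (simp add: telescope del: conv_pow.simps)
qed

lemma conv_antipode_left: "conv antipode basis b = unit_counit b"
proof -
  have "conv antipode basis b = conv (\<lambda>x. \<Sum>k\<le>d b. conv_pow k x) basis b"
    by (intro conv_cong) (metis antipode_eq)
  also have "\<dots> = (\<Sum>k\<le>d b. conv (conv_pow k) basis b)"
    by (simp add: conv_def sum_distrib_right case_prod_beta' lin_ext_fun_sum)
  also have "\<dots> = (\<Sum>k\<le>d b. conv_pow k b - conv_pow (Suc k) b)"
  proof (rule sum.cong[OF refl])
    fix k
    have "conv (conv_pow k) basis b = conv (conv_pow k) unit_counit b - conv (conv_pow k) unit_counit_minus_id b"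
      unfolding conv_def basis_eq
      by (simp add: right_diff_distrib case_prod_beta' lin_ext_fun_diff)
    thus "conv (conv_pow k) basis b = conv_pow k b - conv_pow (Suc k) b"
      by (simp add: conv_unit_right conv_pow_Suc_right del: conv_pow.simps)
  qed
  finally show ?thesis by (simp add: telescope del: conv_pow.simps)
qed

lemma is_antipode_antipode:
  "is_antipode (lin_ext D) (\<lambda>x. Poly_Mapping.lookup x 0) (lin_ext antipode)"
proof -
  have "x \<bind> unit_counit = smult (Poly_Mapping.lookup x 0) 1" for x
    by (induction x rule: vector_induct)
      (auto intro!: poly_mapping_eqI simp: lin_ext_add lin_ext_smult unit_counit_def lookup_add lookup_single when_def algebra_simps)
  moreover have "mult_map (tensor_map (lin_ext antipode) id (lin_ext D x)) = x \<bind> conv antipode basis"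
    "mult_map (tensor_map id (lin_ext antipode) (lin_ext D x)) = x \<bind> conv basis antipode" for x
    by (simp_all add: mult_map_def tensor_map_id lin_ext_bind conv_def[abs_def] case_prod_beta' mult_bind[of "antipode _"] mult_bind[of _ "antipode _"] basis_mult)
  ultimately show ?thesis
    unfolding is_antipode_def
    by (simp add: linear_lin_ext ext[of "conv _ _", OF conv_antipode_left] ext[of "conv _ _", OF conv_antipode_right])
qed

text \<open>
  In \<open>S * id = u\<epsilon>\<close> the terms with trivial right part add up to \<open>S b\<close>, by the counit law.
  All others involve \<open>S\<close> in lower degree only.
\<close>

lemma antipode_homog:
  assumes "is_antipode (lin_ext D) (\<lambda>x. Poly_Mapping.lookup x 0) S"
    and "\<And>a b. d (a + b) = d a + d b"
  shows "homog d (d b) (S (basis b))"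
proof (induction "d b" arbitrary: b rule: less_induct)
  case less
  let ?S = "\<lambda>b. S (basis b)"
  have "mult_map (tensor_map S id (D b)) = unit_counit b"
  proof -
    have "mult_map (tensor_map S id (lin_ext D (basis b))) = smult (Poly_Mapping.lookup (basis b) 0) 1"
      using assms(1) unfolding is_antipode_def by blast
    thus ?thesis by (simp add: unit_counit_def lookup_single when_def of_bool_def)
  qed
  hence S: "conv ?S basis b = unit_counit b"
    by (simp add: mult_map_tensor tensor_map_def mult_map_bind conv_def case_prod_beta')
  \<comment> \<open>separate the terms with trivial right part\<close>
  have "conv ?S basis b = D b \<bind> (\<lambda>(x, y). smult (of_bool (y = 0)) (?S x) +
    (if y = 0 then 0 else ?S x * basis y))"
    unfolding conv_def by (intro lin_ext_cong) auto
  also have "\<dots> = (D b \<bind> (\<lambda>(x, y). smult (of_bool (y = 0)) (basis x))) \<bind> ?S +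
     D b \<bind> (\<lambda>(x, y). if y = 0 then 0 else ?S x * basis y)"
    by (simp add: lin_ext_fun_add lin_ext_bind case_prod_beta' lin_ext_smult)
  finally have "?S b = unit_counit b + smult (-1) (D b \<bind> (\<lambda>(x, y). if y = 0 then 0 else ?S x * basis y))"
    using S by (simp add: counit_r)
  moreover have "homog d (d b) (unit_counit b)"
    by (auto simp: unit_counit_def one_basis d_eq_0_iff simp del: single_one)
  moreover have "homog d (d b) (D b \<bind> (\<lambda>(x, y). if y = 0 then 0 else ?S x * basis y))"
  proof (rule homog_bind[OF homog_D])
    fix k assume k: "d (fst k) + d (snd k) = d b"
    show "homog d (d b) (case k of (x, y) \<Rightarrow> if y = 0 then 0 else ?S x * basis y)"
    proof (cases "snd k = 0")
      case False
      hence "d (fst k) < d b" using k d_eq_0_iff[of "snd k"] by linarith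
      hence "homog d (d (fst k) + d (snd k)) (?S (fst k) * basis (snd k))"
        by (intro homog_mult less assms(2)) simp_all
      thus ?thesis using False k by (simp add: case_prod_beta')
    qed (simp add: case_prod_beta')
  qed
  ultimately show ?case by (simp only:) (intro homog_add homog_smult)
qed

end


section \<open>Coassociativity on trees\<close>

lemma tensor_map_V: "tensor_map V_lin id p = p \<bind> (\<lambda>(a, b). basis (VV a, b))"
  by (simp add: V_lin_def tensor_map_id)

lemma Leaf_plus [simp]: "Leaf + t = t"
  by (simp flip: zero_pbt_def)

lemma plus_VV: "t + VV s = Graft t s"
  by simp

lemma Delta_t_over: "Delta_t (t + s) = Delta_t t * Delta_t s"
  by (induction s) (simp_all add: basis_Leaf_Leaf mult.assoc)

text \<open>This uses \<open>t\<^sub>1 / V(u) = t\<^sub>1 \<or> u\<close>.\<close>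

lemma delta_t_Graft_bind:
  "delta_t (Graft t s) =
    Delta_t t \<bind> (\<lambda>(t1, t2). delta_t s \<bind> (\<lambda>(u, u'). basis (Graft t1 u, t2 + u')))"
  by (simp add: tensor_map_V mult_bind lin_ext_bind case_prod_beta' plus_prod_def)

text \<open>These are \<open>\<Delta> \<otimes> Id\<close>, \<open>Id \<otimes> \<Delta>\<close> and \<open>\<delta> \<otimes> Id\<close> on basis elements.\<close>

definition Delta_fst :: "pbt \<times> pbt \<Rightarrow> (pbt \<times> pbt \<times> pbt \<Rightarrow>\<^sub>0 complex)" where
  "Delta_fst = (\<lambda>(a, b). Delta_t a \<bind> (\<lambda>(c, d). basis (c, d, b)))"

definition Delta_snd :: "pbt \<times> pbt \<Rightarrow> (pbt \<times> pbt \<times> pbt \<Rightarrow>\<^sub>0 complex)" where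
  "Delta_snd = (\<lambda>(a, b). Delta_t b \<bind> (\<lambda>(c, d). basis (a, c, d)))"

definition delta_fst :: "pbt \<times> pbt \<Rightarrow> (pbt \<times> pbt \<times> pbt \<Rightarrow>\<^sub>0 complex)" where
  "delta_fst = (\<lambda>(a, b). delta_t a \<bind> (\<lambda>(c, d). basis (c, d, b)))"

lemma Delta_fst_plus: "Delta_fst (x + y) = Delta_fst x * Delta_fst y"
  by (simp add: Delta_fst_def Delta_t_over mult_bind lin_ext_bind case_prod_beta' plus_prod_def)

lemma Delta_snd_plus: "Delta_snd (x + y) = Delta_snd x * Delta_snd y"
  by (simp add: Delta_snd_def Delta_t_over mult_bind lin_ext_bind case_prod_beta' plus_prod_def)

text \<open>
  Although \<open>delta_t\<close> is not multiplicative (\<open>t / |\<close> gives \<open>delta_t t\<close>, not \<open>Delta_t t\<close>), the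
  product rule \<open>\<delta>(a / b) = \<Delta>(a) / \<delta>(b)\<close> holds when \<open>b\<close> is of the form \<open>V(s)\<close>.
\<close>

lemma delta_fst_Graft: "delta_fst (x + (VV a, b)) = Delta_fst x * delta_fst (VV a, b)"
  by (simp add: Delta_fst_def delta_fst_def mult_bind lin_ext_bind case_prod_beta' plus_prod_def)

lemma delta_coaction_V:
  assumes "delta_t s \<bind> delta_fst = delta_t s \<bind> Delta_snd"
  shows "delta_t (VV s) \<bind> delta_fst = delta_t (VV s) \<bind> Delta_snd"
proof -
  let ?V = "\<lambda>(a::pbt, b::pbt, c::pbt). basis (VV a, b, c)"
  have "delta_t (VV s) \<bind> delta_fst = (delta_t s \<bind> delta_fst) \<bind> ?V"
    by (simp add: delta_fst_def delta_t_V tensor_map_V lin_ext_bind case_prod_beta' plus_prod_def basis_Leaf_Leaf)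
  also have "\<dots> = delta_t (VV s) \<bind> Delta_snd"
    unfolding assms
    by (simp add: Delta_snd_def delta_t_V tensor_map_V lin_ext_bind case_prod_beta' plus_prod_def basis_Leaf_Leaf)
  finally show ?thesis .
qed

text \<open>
  As \<open>\<Delta>\<close> and \<open>\<delta>\<close> differ on \<open>V(x)\<close> by \<open>| \<otimes> V(x)\<close>, both sides have the common summands
  \<open>| \<otimes> | \<otimes> V(s)\<close> and \<open>| \<otimes> \<delta>(V(s))\<close>.  What remains is the coaction identity.
\<close>

lemma Delta_coassoc_V:
  assumes "delta_t (VV s) \<bind> delta_fst = delta_t (VV s) \<bind> Delta_snd"
  shows "Delta_t (VV s) \<bind> Delta_fst = Delta_t (VV s) \<bind> Delta_snd"
proof -
  have "delta_t (VV s) \<bind> Delta_fst =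
    (delta_t (VV s) \<bind> (\<lambda>(a, b). basis (Leaf, a, b))) + (delta_t (VV s) \<bind> delta_fst)"
    by (simp add: Delta_fst_def delta_fst_def Delta_t_V tensor_map_V lin_ext_bind case_prod_beta'
        plus_prod_def basis_Leaf_Leaf lin_ext_add lin_ext_fun_add)
  moreover have "Delta_t (VV s) \<bind> Delta_fst = basis (Leaf, Leaf, VV s) + (delta_t (VV s) \<bind> Delta_fst)"
    unfolding Delta_t_V lin_ext_add lin_ext_basis by (simp add: Delta_fst_def)
  moreover have "Delta_t (VV s) \<bind> Delta_snd =  basis (Leaf, Leaf, VV s) +
    (delta_t (VV s) \<bind> (\<lambda>(a, b). basis (Leaf, a, b))) + (delta_t (VV s) \<bind> Delta_snd)"
    unfolding Delta_t_V lin_ext_add lin_ext_basis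
    by (simp add: Delta_snd_def Delta_t_V lin_ext_add del: Delta_t.simps)
  ultimately show ?thesis using assms by simp
qed

text \<open>
  The two identities are proved together: coassociativity at \<open>V(s)\<close> needs the coaction identity
  for \<open>s\<close>, and the coaction identity at \<open>t \<or> s\<close> needs coassociativity for \<open>t\<close>.
\<close>

lemma coassoc_trees:
  "Delta_t t \<bind> Delta_fst = Delta_t t \<bind> Delta_snd \<and>
   delta_t t \<bind> delta_fst = delta_t t \<bind> Delta_snd"
proof (induction t)
  case Leaf
  show ?case by (simp add: Delta_fst_def Delta_snd_def delta_fst_def)
next
  case (Graft t s)
  have V: "delta_t (VV s) \<bind> delta_fst = delta_t (VV s) \<bind> Delta_snd"
    using Graft delta_coaction_V by blast
  have "Delta_t (Graft t s) \<bind> Delta_fst = Delta_t (Graft t s) \<bind> Delta_snd"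
    unfolding Delta_t_Graft[of t s]
    using Graft(1) Delta_coassoc_V[OF V]
    by (simp only: lin_ext_mult[of Delta_fst, OF Delta_fst_plus] lin_ext_mult[of Delta_snd, OF Delta_snd_plus])
  moreover have "delta_t (Graft t s) \<bind> delta_fst =
    (Delta_t t \<bind> Delta_fst) * (delta_t (VV s) \<bind> delta_fst)"
  proof -
    have *: "delta_t (VV s) = delta_t s \<bind> (\<lambda>x. basis (VV (fst x), snd x))"
      by (simp add: delta_t_V tensor_map_V case_prod_beta' del: delta_t.simps)
    have "delta_fst (x + (VV (fst y), snd y)) = Delta_fst x * delta_fst (VV (fst y), snd y)" for x y
      using delta_fst_Graft[of x "fst y" "snd y"] by simp
    from lin_ext_mult_image[of delta_fst "\<lambda>x. (VV (fst x), snd x)", OF this, of "Delta_t t" "delta_t s"]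
    show ?thesis unfolding delta_t_Graft[of t s] * by (simp only: lin_ext_bind lin_ext_basis)
  qed
  ultimately show ?case using Graft(1) V
    unfolding delta_t_Graft[of t s]
    by (simp only: lin_ext_mult[of Delta_snd, OF Delta_snd_plus])
qed

lemma prune_coassoc:
  "prune_tree t \<bind> (\<lambda>(a, b). prune_tree a \<bind> (\<lambda>(c, d). basis (c, d, b))) =
   prune_tree t \<bind> (\<lambda>(a, b). prune_tree b \<bind> (\<lambda>(c, d). basis (a, c, d)))"
proof (induction t)
  case (Graft t s)
  let ?G = "\<lambda>(a, b :: pbt, c :: pbt). basis (Graft t a, b, c)"
  have "prune_tree (Graft t s) \<bind> (\<lambda>(a, b). prune_tree a \<bind> (\<lambda>(c, d). basis (c, d, b))) =
    basis (Leaf, Leaf, Graft t s) + (prune_tree s \<bind> (\<lambda>(a, b). basis (Leaf, Graft t a, b))) +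
    (prune_tree s \<bind> (\<lambda>(a, b). prune_tree a \<bind> (\<lambda>(c, d). basis (c, d, b)))) \<bind> ?G"
    by (simp add: lin_ext_add lin_ext_bind lin_ext_fun_add case_prod_beta' plus_prod_def)
  also have "\<dots> = prune_tree (Graft t s) \<bind> (\<lambda>(a, b). prune_tree b \<bind> (\<lambda>(c, d). basis (a, c, d)))"
    unfolding Graft
    by (simp add: lin_ext_add lin_ext_bind lin_ext_fun_add case_prod_beta' plus_prod_def)
  finally show ?case .
qed simp

text \<open>
  The pruning coproduct is a morphism of comodules.  The \<open>H_alpha\<close> parts come in the same order
  on both sides, since pruning cuts along the right spine, as the recursion of \<open>delta_t\<close> does.
\<close>

lemma prune_delta:
  "delta_t t \<bind> (\<lambda>(u, u'). prune_tree u \<bind> (\<lambda>(u1, u2). basis (u1, u2, u'))) =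
   prune_tree t \<bind> (\<lambda>(p, q). delta_t p \<bind> (\<lambda>(x, x'). delta_t q \<bind> (\<lambda>(y, y').
     basis (x, y, x' + y'))))"
proof (induction t)
  case (Graft t s)
  let ?G = "\<lambda>(a, b :: pbt, c :: pbt). Delta_t t \<bind> (\<lambda>(t1, t2). basis (Graft t1 a, b, t2 + c))"
  have "delta_t (Graft t s) \<bind> (\<lambda>(u, u'). prune_tree u \<bind> (\<lambda>(u1, u2). basis (u1, u2, u'))) =
    (delta_t (Graft t s) \<bind> (\<lambda>(a, b). basis (Leaf, a, b))) +
    (delta_t s \<bind> (\<lambda>(u, u'). prune_tree u \<bind> (\<lambda>(u1, u2). basis (u1, u2, u')))) \<bind> ?G"
    unfolding delta_t_Graft_bind
    by (simp add: lin_ext_add lin_ext_bind lin_ext_fun_add case_prod_beta' plus_prod_def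
        lin_ext_commute[where p = "Delta_t t"])
  also have "\<dots> = prune_tree (Graft t s) \<bind> (\<lambda>(p, q). delta_t p \<bind> (\<lambda>(x, x'). delta_t q \<bind> (\<lambda>(y, y').
     basis (x, y, x' + y'))))"
    unfolding Graft prune_tree.simps
    by (simp add: lin_ext_add lin_ext_bind lin_ext_fun_add case_prod_beta' plus_prod_def
        delta_t_Graft_bind lin_ext_commute[where p = "Delta_t t"] add.assoc del: delta_t.simps(2))
  finally show ?case .
qed simp


subsection \<open>Counits\<close>

lemma plus_eq_Leaf_iff [simp]: "t + s = Leaf \<longleftrightarrow> t = Leaf \<and> s = Leaf" for t s :: pbt
  by (cases s) auto

lemma counit_left_trees:
  "Delta_t t \<bind> (\<lambda>(a, b). smult (of_bool (a = Leaf)) (basis b)) = basis t \<and>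
   delta_t t \<bind> (\<lambda>(a, b). smult (of_bool (a = Leaf)) (basis b)) = smult (of_bool (t = Leaf)) 1"
   (is "Delta_t t \<bind> ?f = _ \<and> _")
proof (induction t)
  case (Graft t s)
  have f: "?f (x + y) = ?f x * ?f y" for x y
    by (simp add: case_prod_beta' plus_prod_def basis_mult)
  show ?case using Graft unfolding Delta_t_Graft[of t s] delta_t_Graft[of t s] lin_ext_mult[of ?f, OF f]
    by (simp add: lin_ext_add lin_ext_bind tensor_map_V case_prod_beta' basis_Leaf_Leaf basis_mult)
qed (simp_all add: zero_pbt_def flip: single_one)

lemma counit_right_trees:
  "Delta_t t \<bind> (\<lambda>(a, b). smult (of_bool (b = Leaf)) (basis a)) = basis t \<and>
   delta_t t \<bind> (\<lambda>(a, b). smult (of_bool (b = Leaf)) (basis a)) = basis t"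
   (is "Delta_t t \<bind> ?f = _ \<and> _")
proof (induction t)
  case (Graft t s)
  have f: "?f (x + y) = ?f x * ?f y" for x y
    by (simp add: case_prod_beta' plus_prod_def basis_mult)
  have "delta_t (VV s) \<bind> ?f = (delta_t s \<bind> ?f) \<bind> (\<lambda>a. basis (VV a))"
    by (simp add: lin_ext_bind tensor_map_V case_prod_beta' basis_Leaf_Leaf lin_ext_smult)
  hence "delta_t (VV s) \<bind> ?f = basis (VV s)" using Graft by simp
  thus ?case using Graft unfolding Delta_t_Graft[of t s] delta_t_Graft[of t s] lin_ext_mult[of ?f, OF f]
      Delta_t_V
    by (simp add: lin_ext_add basis_mult del: Delta_t.simps delta_t.simps)
qed simp_all

lemma prune_counit_right: "prune_tree t \<bind> (\<lambda>(a, b). smult (of_bool (b = Leaf)) (basis a)) = basis t"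
   (is "prune_tree t \<bind> ?f = _")
proof (induction t)
  case (Graft t s)
  have "prune_tree (Graft t s) \<bind> ?f = (prune_tree s \<bind> ?f) \<bind> (\<lambda>a. basis (Graft t a))"
    by (simp add: lin_ext_add lin_ext_bind case_prod_beta' lin_ext_smult)
  thus ?case unfolding Graft by simp
qed simp

lemma prune_counit_left: "prune_tree t \<bind> (\<lambda>(a, b). smult (of_bool (a = Leaf)) (basis b)) = basis t"
  by (cases t) (simp_all add: lin_ext_add lin_ext_bind case_prod_beta')

lemma order_plus [simp]: "order (t + s) = order t + order s"
  by (induction s) auto

lemma homog_trees:
  "homog (pair_degree order) (order t) (Delta_t t) \<and> homog (pair_degree order) (order t) (delta_t t)"
proof (induction t)
  case (Graft t s)
  let ?h = "homog (pair_degree order)"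
  have 1: "?h (order (VV s)) (delta_t (VV s))"
    unfolding delta_t_V tensor_map_V using Graft by (auto intro!: homog_bind[of "pair_degree order" "order s"])
  hence "?h (order (VV s)) (Delta_t (VV s))"
    unfolding Delta_t_V by (intro homog_add) simp_all
  with 1 have "?h (order t + order (VV s)) (Delta_t t * Delta_t (VV s))"
    "?h (order t + order (VV s)) (Delta_t t * delta_t (VV s))"
    using Graft by (intro homog_mult; simp)+
  thus ?case unfolding Delta_t_Graft[of t s] delta_t_Graft[of t s] by simp
qed simp_all

lemma homog_prune: "homog (pair_degree order) (order t) (prune_tree t)"
  by (induction t) (auto intro!: homog_add homog_bind[of "pair_degree order" "order _"])

section \<open>The smash coproduct on generators\<close>

text \<open>The basis monomials \<open>\<pi>(t) \<otimes> 1\<close> and \<open>1 \<otimes> t\<close>.\<close>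

definition alpha_monom :: "pbt \<Rightarrow> qed_monom" where
  "alpha_monom t = (abelian_monom t, 0)"

definition beta_monom :: "pbt \<Rightarrow> qed_monom" where
  "beta_monom t = ({#}, word_of t)"

lemma letters_plus [simp]: "letters (v + w) = letters v @ letters w"
  using letters[of v] letters[of w] by (simp add: plus_tree_word_def Abs_tree_word_inverse)

lemma letters_zero [simp]: "letters 0 = []"
  by (simp add: zero_tree_word_def Abs_tree_word_inverse)

lemma letters_word_of: "letters (word_of t) = (if t = Leaf then [] else [t])"
  by (simp add: word_of_def Abs_tree_word_inverse)

lemma word_of_Leaf [simp]: "word_of Leaf = 0"
  by (simp add: word_of_def zero_tree_word_def)

lemma tree_word_eq_iff: "v = w \<longleftrightarrow> letters v = letters w"
  by (simp add: letters_inject)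

lemma alpha_monom_plus: "alpha_monom (t + s) = alpha_monom t + alpha_monom s"
  by (simp add: alpha_monom_def abelian_monom_over)

lemma alpha_monom_Leaf [simp]: "alpha_monom Leaf = 0"
  and beta_monom_Leaf [simp]: "beta_monom Leaf = 0"
  by (simp_all add: alpha_monom_def beta_monom_def zero_prod_def)

lemma word_induct [case_names zero snoc]:
  assumes "P 0" "\<And>w t. P w \<Longrightarrow> P (w + word_of t)"
  shows "P w"
proof -
  have "\<forall>w. letters w = xs \<longrightarrow> P w" for xs
  proof (induction xs rule: rev_induct)
    case Nil
    show ?case using assms(1) by (metis letters_zero tree_word_eq_iff)
  next
    case (snoc t xs)
    show ?case
    proof (intro allI impI)
      fix w assume w: "letters w = xs @ [t]"
      hence "Leaf \<notin> set (xs @ [t])" using letters[of w] by simp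
      hence "letters (Abs_tree_word xs) = xs" "w = Abs_tree_word xs + word_of t"
        using w by (auto simp: Abs_tree_word_inverse tree_word_eq_iff letters_word_of)
      thus "P w" using snoc assms(2) by blast
    qed
  qed
  thus ?thesis by blast
qed

lemma qed_monom_induct [case_names zero plus alpha beta]:
  assumes "P 0" "\<And>m n. P m \<Longrightarrow> P n \<Longrightarrow> P (m + n)"
    "\<And>t. P (alpha_monom t)" "\<And>t. P (beta_monom t)"
  shows "P m"
proof -
  obtain M w where m: "m = (M, 0) + ({#}, w)" by (cases m) simp
  have "P (M, 0)"
  proof (induction M)
    case empty
    show ?case using assms(1) by (simp add: zero_prod_def)
  next
    case (add t M)
    have "(add_mset t M, 0) = (M, 0) + alpha_monom (VV t)" by (simp add: alpha_monom_def)
    thus ?case using add assms(2,3) by metis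
  qed
  moreover have "P ({#}, w)"
  proof (induction w rule: word_induct)
    case zero
    show ?case using assms(1) by (simp add: zero_prod_def)
  next
    case (snoc w t)
    have "({#}, w + word_of t) = ({#}, w) + beta_monom t" by (simp add: beta_monom_def)
    thus ?case using snoc assms(2,4) by metis
  qed
  ultimately show ?thesis unfolding m by (rule assms(2))
qed

definition qed_coprod :: "qed_monom \<Rightarrow> (qed_monom \<times> qed_monom \<Rightarrow>\<^sub>0 complex)" where
  "qed_coprod = (\<lambda>(a, b).
       qed_combine (Delta_alpha (basis a) \<otimes> tensor_map coaction_e id (Delta_e (basis b))))"

lemma Delta_qed_lin_ext: "Delta_qed = lin_ext qed_coprod"
  by (simp add: Delta_qed_def qed_coprod_def)

lemma coaction_e_word_plus:
  "coaction_e (basis (v + w)) = coaction_e (basis v) * coaction_e (basis w)"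
  by (simp add: coaction_e_def)

text \<open>Commutativity of \<open>H_alpha\<close> enters here, through the multiplicativity of \<open>qed_combine\<close>.\<close>

lemma qed_coprod_plus: "qed_coprod (m + n) = qed_coprod m * qed_coprod n"
proof -
  obtain a b a' b' where mn: "m = (a, b)" "n = (a', b')" by fastforce
  have 1: "Delta_alpha (basis (a + a')) = Delta_alpha (basis a) * Delta_alpha (basis a')"
    by (simp add: Delta_alpha_def)
  have 2: "Delta_e (basis (b + b')) = Delta_e (basis b) * Delta_e (basis b')"
    by (simp add: Delta_e_def)
  have 3: "tensor_map coaction_e id (p * q) = tensor_map coaction_e id p * tensor_map coaction_e id q" for p q
    unfolding tensor_map_def
    by (rule lin_ext_mult)
      (simp add: case_prod_beta' plus_prod_def coaction_e_word_plus tensor_mult basis_mult)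
  have 4: "qed_combine (p * q) = qed_combine p * qed_combine q" for p q
    unfolding qed_combine_def
    by (rule lin_ext_mult) (simp add: case_prod_beta' plus_prod_def basis_mult ac_simps)
  show ?thesis
    unfolding qed_coprod_def mn by (simp add: 1 2 3 4 flip: tensor_mult)
qed

lemma qed_coprod_zero [simp]: "qed_coprod 0 = 1"
proof -
  have "coaction_e (basis 0) = 1" "Delta_alpha (basis {#}) = 1" "Delta_e (basis 0) = 1"
    by (simp_all add: coaction_e_def Delta_alpha_def Delta_e_def del: single_one)
  thus ?thesis
    by (simp add: qed_coprod_def zero_prod_def one_pair tensor_map_def qed_combine_def basis_mult del: single_one)
qed

lemma coaction_e_tensor_one: "tensor_map coaction_e id 1 = 1"
  by (simp add: one_pair tensor_map_def tensor_bind coaction_e_def zero_prod_def del: single_one)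

lemma qed_coprod_alpha:
  "qed_coprod (alpha_monom t) = Delta_t t \<bind> (\<lambda>(a, b). basis (alpha_monom a, alpha_monom b))"
proof (induction t)
  case Leaf
  show ?case by (simp flip: zero_prod_def)
next
  case (Graft t s)
  let ?f = "\<lambda>(a, b). basis (alpha_monom a, alpha_monom b)"
  have f: "?f (x + y) = ?f x * ?f y" for x y
    by (simp add: case_prod_beta' plus_prod_def alpha_monom_plus basis_mult)
  have "qed_coprod (alpha_monom (VV s)) = Delta_t (VV s) \<bind> ?f"
    unfolding qed_coprod_def alpha_monom_def
    by (simp del: Delta_t.simps add: coaction_e_tensor_one Delta_alpha_def Delta_e_def Delta_tilde_def ab_proj_def tensor_map_lin_ext
        tensor_bind qed_combine_def lin_ext_bind case_prod_beta' basis_mult)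
  thus ?case using Graft alpha_monom_plus[of t "VV s"]
    by (simp only: plus_VV qed_coprod_plus Delta_t_Graft[of t s] lin_ext_mult[of ?f, OF f])
qed

lemma Delta_e_word_of: "Delta_e (basis (word_of t)) = prune_tree t \<bind> (\<lambda>(a, b). basis (word_of a, word_of b))"
  by (cases "t = Leaf")
    (simp_all add: Delta_e_def letters_word_of embed_e_def tensor_map_lin_ext flip: zero_prod_def)

lemma coaction_e_word_of:
  "coaction_e (basis (word_of t)) = delta_t t \<bind> (\<lambda>(a, b). basis (word_of a, abelian_monom b))"
  by (cases "t = Leaf")
    (simp_all add: coaction_e_def letters_word_of embed_e_def ab_proj_def delta_tilde_def tensor_map_lin_ext
      flip: zero_prod_def)

lemma qed_coprod_beta:
  "qed_coprod (beta_monom t) = prune_tree t \<bind> (\<lambda>(p, q). delta_t p \<bind> (\<lambda>(x, x').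
     basis (beta_monom x, alpha_monom x' + beta_monom q)))"
  unfolding qed_coprod_def
  by (simp add: beta_monom_def Delta_e_word_of tensor_map_def coaction_e_word_of Delta_alpha_def
    tensor_bind qed_combine_def lin_ext_bind case_prod_beta' basis_mult alpha_monom_def)


section \<open>The bialgebra axioms\<close>

lemma qed_monom_eqI:
  assumes "\<And>m n. F (m + n) = F m * F n" "\<And>m n. G (m + n) = G m * G n" "F 0 = G 0"
    "\<And>t. F (alpha_monom t) = G (alpha_monom t)" "\<And>t. F (beta_monom t) = G (beta_monom t)"
  shows "F m = G m"
  by (induction m rule: qed_monom_induct) (simp_all add: assms)

text \<open>
  On \<open>\<beta>(t)\<close>, start from \<open>(\<Delta> \<otimes> Id) \<Delta>\<close>: \<open>prune_delta\<close> makes the inner pruning act before the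
  coactions, \<open>coassoc_trees\<close> turns the iterated coaction into a coproduct of the second part, and
  \<open>prune_coassoc\<close> moves the second pruning to the right factor.
\<close>

lemma qed_coassoc:
  "qed_coprod m \<bind> (\<lambda>(a, b). qed_coprod a \<bind> (\<lambda>(c, d). basis (c, d, b))) =
   qed_coprod m \<bind> (\<lambda>(a, b). qed_coprod b \<bind> (\<lambda>(c, d). basis (a, c, d)))"
   (is "qed_coprod m \<bind> ?L = qed_coprod m \<bind> ?R")
proof (induction m rule: qed_monom_eqI)
  case (1 m n)
  have "?L (x + y) = ?L x * ?L y" for x y
    by (simp add: qed_coprod_plus mult_bind lin_ext_bind case_prod_beta')
  thus ?case unfolding qed_coprod_plus by (rule lin_ext_mult)
next
  case (2 m n)
  have "?R (x + y) = ?R x * ?R y" for x y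
    by (simp add: qed_coprod_plus mult_bind lin_ext_bind case_prod_beta')
  thus ?case unfolding qed_coprod_plus by (rule lin_ext_mult)
next
  case 3
  show ?case by (simp add: case_prod_beta') (simp add: zero_prod_def)
next
  case (4 t)
  let ?A = "\<lambda>(a, b, c). basis (alpha_monom a, alpha_monom b, alpha_monom c)"
  have "qed_coprod (alpha_monom t) \<bind> ?L = (Delta_t t \<bind> Delta_fst) \<bind> ?A"
    by (simp add: qed_coprod_alpha lin_ext_bind Delta_fst_def case_prod_beta')
  also have "\<dots> = qed_coprod (alpha_monom t) \<bind> ?R"
    unfolding coassoc_trees[THEN conjunct1]
    by (simp add: qed_coprod_alpha lin_ext_bind Delta_snd_def case_prod_beta')
  finally show ?case .
next
  case (5 t)
  let ?a = alpha_monom and ?b = beta_monom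
  \<comment> \<open>\<open>X p\<close> is kept folded so that its two dependent summations move past the others as one\<close>
  define X where "X p = delta_t p \<bind> Delta_snd" for p
  let ?M = "\<lambda>(p, q, s). delta_t q \<bind> (\<lambda>(y, y'). (delta_t p \<bind> delta_fst) \<bind>
    (\<lambda>(v, v', x'). basis (?b v, ?a v' + ?b y, ?a (x' + y') + ?b s)))"
  have "qed_coprod (?b t) \<bind> ?L = prune_tree t \<bind> (\<lambda>(r, s).
    (delta_t r \<bind> (\<lambda>(u, u'). prune_tree u \<bind> (\<lambda>(u1, u2). basis (u1, u2, u')))) \<bind>
    (\<lambda>(x, y, z). delta_t x \<bind> (\<lambda>(v, v'). basis (?b v, ?a v' + ?b y, ?a z + ?b s))))"
    by (simp add: qed_coprod_beta lin_ext_bind case_prod_beta')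
  also have "\<dots> = prune_tree t \<bind> (\<lambda>(r, s). prune_tree r \<bind> (\<lambda>(p, q).
      delta_t p \<bind> (\<lambda>(x, x'). delta_t q \<bind> (\<lambda>(y, y'). delta_t x \<bind>
        (\<lambda>(v, v'). basis (?b v, ?a v' + ?b y, ?a (x' + y') + ?b s))))))"
    unfolding prune_delta by (simp add: lin_ext_bind case_prod_beta')
  also have "\<dots> = (prune_tree t \<bind> (\<lambda>(r, s). prune_tree r \<bind> (\<lambda>(p, q). basis (p, q, s)))) \<bind> ?M"
    by (simp add: lin_ext_bind case_prod_beta' delta_fst_def lin_ext_commute[where p = "delta_t (fst _)" and q = "delta_t (snd _)"])
  also have "\<dots> = prune_tree t \<bind> (\<lambda>(p, s'). prune_tree s' \<bind> (\<lambda>(q, s).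
      delta_t q \<bind> (\<lambda>(y, y'). X p \<bind>
        (\<lambda>(v, v', x'). basis (?b v, ?a v' + ?b y, ?a (x' + y') + ?b s)))))"
    unfolding prune_coassoc coassoc_trees[THEN conjunct2] X_def[symmetric]
    by (simp add: lin_ext_bind case_prod_beta')
  also have "\<dots> = prune_tree t \<bind> (\<lambda>(p, s'). X p \<bind> (\<lambda>(v, v', x').
      prune_tree s' \<bind> (\<lambda>(q, s). delta_t q \<bind>
        (\<lambda>(y, y'). basis (?b v, ?a v' + ?b y, ?a (x' + y') + ?b s)))))"
    by (simp add: case_prod_beta' lin_ext_commute[where q = "X _"])
  also have "\<dots> = qed_coprod (?b t) \<bind> ?R"
    by (simp add: X_def qed_coprod_beta qed_coprod_alpha qed_coprod_plus mult_bind lin_ext_bind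
        case_prod_beta' Delta_snd_def alpha_monom_plus add.assoc)
  finally show ?case .
qed

lemma abelian_monom_eq_empty_iff [simp]: "abelian_monom t = {#} \<longleftrightarrow> t = Leaf"
  by (cases t) auto

lemma word_of_eq_0_iff [simp]: "word_of t = 0 \<longleftrightarrow> t = Leaf"
  by (simp add: tree_word_eq_iff letters_word_of)

lemma alpha_monom_eq_0_iff [simp]: "alpha_monom t = 0 \<longleftrightarrow> t = Leaf"
  and beta_monom_eq_0_iff [simp]: "beta_monom t = 0 \<longleftrightarrow> t = Leaf"
  by (simp_all add: alpha_monom_def beta_monom_def zero_prod_def)

lemma qed_monom_plus_eq_0_iff [simp]: "m + n = 0 \<longleftrightarrow> m = 0 \<and> n = 0" for m n :: qed_monom
  by (cases m; cases n) (auto simp: zero_prod_def tree_word_eq_iff)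

lemma qed_counit_left:
  "qed_coprod m \<bind> (\<lambda>(a, b). smult (of_bool (a = 0)) (basis b)) = basis m"
  (is "_ \<bind> ?f = _")
proof (induction m rule: qed_monom_eqI)
  case (1 m n)
  have "?f (x + y) = ?f x * ?f y" for x y
    by (simp add: case_prod_beta' basis_mult)
  thus ?case unfolding qed_coprod_plus by (rule lin_ext_mult)
next
  case (4 t)
  have "qed_coprod (alpha_monom t) \<bind> ?f =
    (Delta_t t \<bind> (\<lambda>(a, b). smult (of_bool (a = Leaf)) (basis b))) \<bind> (\<lambda>x. basis (alpha_monom x))"
    by (simp add: qed_coprod_alpha lin_ext_bind case_prod_beta' lin_ext_smult)
  thus ?case by (simp add: counit_left_trees)
next
  case (5 t)
  have "qed_coprod (beta_monom t) \<bind> ?f = prune_tree t \<bind> (\<lambda>(p, q).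
     (delta_t p \<bind> (\<lambda>(a, b). smult (of_bool (a = Leaf)) (basis b))) \<bind>
     (\<lambda>x. basis (alpha_monom x + beta_monom q)))"
    by (simp add: qed_coprod_beta lin_ext_bind case_prod_beta' lin_ext_smult)
  also have "\<dots> = (prune_tree t \<bind> (\<lambda>(p, q). smult (of_bool (p = Leaf)) (basis q))) \<bind>
     (\<lambda>q. basis (beta_monom q))"
    unfolding counit_left_trees[THEN conjunct2]
    by (simp add: lin_ext_bind case_prod_beta' lin_ext_smult zero_pbt_def)
  finally show ?case by (simp add: prune_counit_left)
qed (simp_all add: case_prod_beta' basis_mult)

lemma qed_counit_right:
  "qed_coprod m \<bind> (\<lambda>(a, b). smult (of_bool (b = 0)) (basis a)) = basis m"
  (is "_ \<bind> ?f = _")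
proof (induction m rule: qed_monom_eqI)
  case (1 m n)
  have "?f (x + y) = ?f x * ?f y" for x y
    by (simp add: case_prod_beta' basis_mult)
  thus ?case unfolding qed_coprod_plus by (rule lin_ext_mult)
next
  case (4 t)
  have "qed_coprod (alpha_monom t) \<bind> ?f =
    (Delta_t t \<bind> (\<lambda>(a, b). smult (of_bool (b = Leaf)) (basis a))) \<bind> (\<lambda>x. basis (alpha_monom x))"
    by (simp add: qed_coprod_alpha lin_ext_bind case_prod_beta' lin_ext_smult)
  thus ?case by (simp add: counit_right_trees)
next
  case (5 t)
  have "qed_coprod (beta_monom t) \<bind> ?f = prune_tree t \<bind> (\<lambda>(p, q). smult (of_bool (q = Leaf))
     ((delta_t p \<bind> (\<lambda>(a, b). smult (of_bool (b = Leaf)) (basis a))) \<bind> (\<lambda>x. basis (beta_monom x))))"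
    by (simp add: qed_coprod_beta lin_ext_bind case_prod_beta' lin_ext_smult of_bool_conj mult.commute flip: lin_ext_fun_smult)
  also have "\<dots> = (prune_tree t \<bind> (\<lambda>(p, q). smult (of_bool (q = Leaf)) (basis p))) \<bind>
     (\<lambda>q. basis (beta_monom q))"
    unfolding counit_right_trees[THEN conjunct2]
    by (simp add: lin_ext_bind case_prod_beta' lin_ext_smult)
  finally show ?case by (simp add: prune_counit_right)
qed (simp_all add: case_prod_beta' basis_mult)


lemma qed_degree_plus [simp]: "qed_degree (m + n) = qed_degree m + qed_degree n"
  by (cases m; cases n) simp

lemma qed_degree_alpha [simp]: "qed_degree (alpha_monom t) = order t"
  by (induction t) (simp_all add: alpha_monom_def)

lemma qed_degree_beta [simp]: "qed_degree (beta_monom t) = order t"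
  by (simp add: beta_monom_def letters_word_of)

lemma order_eq_0_iff [simp]: "order t = 0 \<longleftrightarrow> t = Leaf"
  by (cases t) auto

lemma qed_degree_eq_0_iff: "qed_degree m = 0 \<longleftrightarrow> m = 0"
proof (cases m)
  case (Pair M w)
  have "(\<forall>t\<in>set (letters w). t = Leaf) \<longleftrightarrow> letters w = []"
  proof -
    have "Leaf \<notin> set (letters w)" using letters[of w] by simp
    thus ?thesis by (metis list.set_intros(1) list.exhaust empty_iff list.set(1))
  qed
  also have "\<dots> \<longleftrightarrow> w = 0" by (simp add: tree_word_eq_iff)
  finally show ?thesis by (auto simp add: Pair zero_prod_def)
qed

lemma homog_qed_coprod: "homog (pair_degree qed_degree) (qed_degree m) (qed_coprod m)"
proof (induction m rule: qed_monom_induct)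
  case zero
  show ?case by (simp add: one_basis qed_degree_eq_0_iff del: single_one)
next
  case (plus m n)
  thus ?case unfolding qed_coprod_plus qed_degree_plus by (rule homog_mult) simp
next
  case (alpha t)
  show ?case unfolding qed_coprod_alpha using homog_trees[of t]
    by (auto intro!: homog_bind[of "pair_degree order" "order t"])
next
  case (beta t)
  show ?case unfolding qed_coprod_beta
  proof (rule homog_bind[OF homog_prune])
    fix k :: "pbt \<times> pbt" assume "order (fst k) + order (snd k) = order t"
    thus "homog (pair_degree qed_degree) (qed_degree (beta_monom t)) (case k of (p, q) \<Rightarrow>
        delta_t p \<bind> (\<lambda>(x, x'). basis (beta_monom x, alpha_monom x' + beta_monom q)))"
      by (auto simp: case_prod_beta' intro!: homog_bind[OF homog_trees[THEN conjunct2]])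
  qed
qed


section \<open>The graded connected Hopf algebra\<close>

lemma eps_qed_eq: "eps_qed x = Poly_Mapping.lookup x 0"
proof -
  have "eps_alpha (basis a) * eps_e (basis b) = of_bool ((a, b) = 0)" for a b
    by (auto simp: eps_alpha_def eps_e_def lookup_single when_def zero_prod_def)
  hence "eps_qed x = (\<Sum>p\<in>Poly_Mapping.keys x. if p = 0 then Poly_Mapping.lookup x 0 else 0)"
    unfolding eps_qed_def by (intro sum.cong) auto
  thus ?thesis by (simp add: in_keys_iff)
qed

theorem mainTheorem2:
  shows "is_graded_connected_hopf_algebra Delta_qed eps_qed qed_component \<and>
    \<not> (\<forall>x y :: H_qed. x * y = y * x) \<and>
    \<not> cocommutative Delta_qed"
proof (intro conjI)
  interpret connected_coproduct qed_coprod qed_degree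
    by unfold_locales (rule qed_coassoc qed_counit_left qed_counit_right homog_qed_coprod qed_degree_eq_0_iff)+
  have eps: "eps_qed = (\<lambda>x. Poly_Mapping.lookup x 0)" by (simp add: fun_eq_iff eps_qed_eq)
  have comp: "qed_component = (\<lambda>n. {p. homog qed_degree n p})"
    by (rule ext) (simp only: qed_component_def span_basis)
  have lookup_basis: "Poly_Mapping.lookup (basis m) 0 = of_bool (m = 0)" for m :: qed_monom
    by (simp add: lookup_single when_def)
  have coalg: "is_coalgebra Delta_qed eps_qed"
    unfolding is_coalgebra_def
  proof (intro conjI allI)
    show "Vector_Spaces.linear smult smult Delta_qed"
      unfolding Delta_qed_lin_ext by (rule linear_lin_ext)
    show "Vector_Spaces.linear smult (*) eps_qed"
      unfolding eps
      by unfold_locales (auto intro!: poly_mapping_eqI simp: lookup_add algebra_simps)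
    fix x
    show "tensor_assoc (tensor_map Delta_qed id (Delta_qed x)) = tensor_map id Delta_qed (Delta_qed x)"
      using qed_coassoc by (simp add: tensor_assoc_def Delta_qed_lin_ext tensor_map_id lin_ext_bind case_prod_beta')
    show "counit_left eps_qed (Delta_qed x) = x"
      using qed_counit_left by (simp add: counit_left_def eps lookup_basis Delta_qed_lin_ext lin_ext_bind)
    show "counit_right eps_qed (Delta_qed x) = x"
      using qed_counit_right by (simp add: counit_right_def eps lookup_basis Delta_qed_lin_ext lin_ext_bind)
  qed
  have "eps_qed (x * y) = eps_qed x * eps_qed y" for x y
  proof -
    have *: "eps_qed (p + q) = eps_qed p + eps_qed q" "eps_qed (smult c p) = c * eps_qed p" "eps_qed 0 = 0" for p q c
      by (simp_all add: eps lookup_add)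
    show ?thesis
    proof (induction x rule: vector_induct)
      case (basis m)
      show ?case
        by (induction y rule: vector_induct)
          (simp_all add: * ring_distribs smult_mult_right basis_mult, simp add: eps lookup_basis)
    qed (simp_all add: * ring_distribs smult_mult_left)
  qed
  with coalg have bialg: "is_bialgebra Delta_qed eps_qed"
    unfolding is_bialgebra_def
    by (auto simp: Delta_qed_lin_ext lin_ext_mult qed_coprod_plus, simp add: eps one_basis lookup_basis del: single_one)
  show "is_graded_connected_hopf_algebra Delta_qed eps_qed qed_component"
    unfolding is_graded_connected_hopf_algebra_def
  proof (intro conjI allI ballI impI)
    show "is_hopf_algebra Delta_qed eps_qed"
      unfolding is_hopf_algebra_def using bialg is_antipode_antipode by (auto simp: eps Delta_qed_lin_ext)
    show "is_grading qed_component" unfolding comp by (rule is_grading_homog)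
    show "1 \<in> qed_component 0" by (simp add: comp one_basis qed_degree_eq_0_iff del: single_one)
    show "qed_component 0 = module.span smult {1}"
      unfolding qed_component_def qed_degree_eq_0_iff one_basis by (rule arg_cong[of _ _ "module.span smult"]) blast
  next
    fix m n x y assume "x \<in> qed_component m" "y \<in> qed_component n"
    thus "x * y \<in> qed_component (m + n)" by (auto simp: comp intro: homog_mult)
  next
    fix n x assume "x \<in> qed_component n"
    thus "Delta_qed x \<in> tensor_grading qed_component n"
      unfolding comp tensor_grading_homog Delta_qed_lin_ext
      using homog_qed_coprod by (auto intro!: homog_bind[of qed_degree n])
  next
    fix n :: nat and x assume "n > 0" "x \<in> qed_component n"
    thus "eps_qed x = 0"
      using qed_degree_eq_0_iff[of 0] homog_lookup[of qed_degree n x 0] by (simp add: comp eps)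
  next
    fix S n x assume S: "is_antipode Delta_qed eps_qed S" and x: "x \<in> qed_component n"
    then interpret S: Vector_Spaces.linear smult smult S by (simp add: is_antipode_def)
    have "S x = x \<bind> (\<lambda>b. S (basis b))"
      by (induction x rule: vector_induct) (simp_all add: S.add S.scale lin_ext_add lin_ext_smult)
    moreover have "homog qed_degree (qed_degree b) (S (basis b))" for b
      using S unfolding Delta_qed_lin_ext eps by (rule antipode_homog) simp
    ultimately show "S x \<in> qed_component n"
      using x by (auto simp: comp intro!: homog_bind[of qed_degree n])
  qed
  let ?Y = "VV Leaf"
  let ?x = "beta_monom ?Y" and ?y = "beta_monom (VV ?Y)"
  have "?x + ?y \<noteq> ?y + ?x"
    by (simp add: beta_monom_def tree_word_eq_iff letters_word_of)
  hence "basis ?x * basis ?y \<noteq> basis ?y * basis ?x"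
    unfolding basis_mult by (metis lookup_single_eq lookup_single_not_eq zero_neq_one)
  thus "\<not> (\<forall>x y :: H_qed. x * y = y * x)" by blast
  \<comment> \<open>The term \<open>\<beta>(V(|)) \<otimes> \<alpha>(V(|))\<close> in the coproduct of \<open>\<beta>(V(|) \<or> |)\<close> comes from the coaction and
    has no mirror image.\<close>
  let ?t = "Graft ?Y Leaf"
  have delta: "delta_t ?t = basis (?Y, ?Y) + basis (?t, Leaf)"
    by (simp add: tensor_map_V ring_distribs basis_mult)
  have prune: "prune_tree ?t = basis (Leaf, ?t) + basis (?t, Leaf)"
    by simp
  have "Delta_qed (basis (beta_monom ?t)) = basis (0, beta_monom ?t) +
    (basis (beta_monom ?Y, alpha_monom ?Y) + basis (beta_monom ?t, 0))"
    unfolding Delta_qed_lin_ext lin_ext_basis qed_coprod_beta prune lin_ext_add prod.case delta by simp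
  moreover have "alpha_monom ?Y \<noteq> beta_monom ?Y"
    by (simp add: alpha_monom_def beta_monom_def)
  ultimately have "Poly_Mapping.lookup (Delta_qed (basis (beta_monom ?t))) (beta_monom ?Y, alpha_monom ?Y) \<noteq>
    Poly_Mapping.lookup (tensor_swap (Delta_qed (basis (beta_monom ?t)))) (beta_monom ?Y, alpha_monom ?Y)"
    by (simp add: tensor_swap_def lin_ext_add lookup_add lookup_single when_def)
  thus "\<not> cocommutative Delta_qed" unfolding cocommutative_def by metis
qed

end
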